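(* Fix $h>0$ and let $p,q:\mathbb{R}\to\mathbb{C}$ be $1$-periodic functions with $p,q\in L^\infty(\mathbb{R})$. Let $\sigma(\mathfrak{D})\subset\mathbb{C}$ be the $L^2(\mathbb{R})^2$-spectrum of the Dirac operator $\mathfrak{D}$ with potentials $p,q$ and semiclassical parameter $h$. If $z\in\sigma(\mathfrak{D})$, then $$|\operatorname{Im} z|\le\left(\|p\|_\infty\|q\|_\infty\right)^{1/2}.$$
   Context: The Dirac operator is the differential expression $\mathfrak{D}:= ih\sigma_3\partial_x + Q(x)$, $x\in\mathbb{R}$, where $i$ is the imaginary unit, $h>0$ is the semiclassical parameter, $\sigma_3=\begin{pmatrix}1&0\\0&-1\end{pmatrix}$ and $Q(x)=\begin{pmatrix}0&-iq(x)\\ ip(x)&0\end{pmatrix}$. It is realized as the densely and maximally defined closed operator $H\Psi=\mathfrak{D}\Psi$ in $L^2(\mathbb{R})^2=L^2(\mathbb{R};\mathbb{C}^2)$ with domain $\{\Psi\in L^2(\mathbb{R})^2:\Psi\in AC_{\rm loc}(\mathbb{R})^2,\ \mathfrak{D}\Psi\in L^2(\mathbb{R})^2\}$, where $AC_{\rm loc}(\mathbb{R})$ denotes the locally absolutely continuous complex-valued functions. $\sigma(\mathfrak{D})$ denotes the spectrum of this operator. $\|\cdot\|_\infty$ is the $L^\infty(\mathbb{R})$ (essential supremum) norm. *)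

theory Defs
  imports "HOL-Analysis.Analysis" "HOL-Probability.Essential_Supremum"
begin

definition Linf_norm :: "(real \<Rightarrow> complex) \<Rightarrow> real" where
  "Linf_norm f = real_of_ereal (esssup lebesgue (\<lambda>x. ereal (cmod (f x))))"

definition Linf :: "(real \<Rightarrow> complex) set" where
  "Linf = {f \<in> borel_measurable lebesgue. esssup lebesgue (\<lambda>x. ereal (cmod (f x))) < \<infinity>}"

text \<open>
  Elements of \<open>L\<^sup>2(\<real>; \<complex>\<^sup>2)\<close> are handled through representatives; equality of elements is
  equality almost everywhere. The norm on \<open>complex ^ 2\<close> is the Euclidean one.
\<close>

definition L2 :: "(real \<Rightarrow> complex ^ 2) set" where
  "L2 = {\<Psi> \<in> borel_measurable lebesgue. integrable lebesgue (\<lambda>x. (norm (\<Psi> x))\<^sup>2)}"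

definition L2_norm :: "(real \<Rightarrow> complex ^ 2) \<Rightarrow> real" where
  "L2_norm \<Psi> = sqrt (LINT x|lebesgue. (norm (\<Psi> x))\<^sup>2)"

text \<open>
  The usual \<open>\<epsilon>\<close>-\<open>\<delta>\<close> definition; a family of non-overlapping compact subintervals is a
  division of its union.
\<close>

definition abs_cont_on_interval :: "real \<Rightarrow> real \<Rightarrow> (real \<Rightarrow> complex) \<Rightarrow> bool" where
  "abs_cont_on_interval a b f \<longleftrightarrow>
     (\<forall>\<epsilon>>0. \<exists>\<delta>>0. \<forall>d. d division_of \<Union>d \<and> \<Union>d \<subseteq> {a..b} \<and> (\<Sum>K\<in>d. measure lborel K) < \<delta>
        \<longrightarrow> (\<Sum>K\<in>d. cmod (f (Sup K) - f (Inf K))) < \<epsilon>)"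

definition AC_loc :: "(real \<Rightarrow> complex) set" where
  "AC_loc = {f. \<forall>a b. abs_cont_on_interval a b f}"

definition sigma3 :: "complex ^ 2 ^ 2" where
  "sigma3 = vector [vector [1, 0], vector [0, -1]]"

definition potential :: "(real \<Rightarrow> complex) \<Rightarrow> (real \<Rightarrow> complex) \<Rightarrow> real \<Rightarrow> complex ^ 2 ^ 2" where
  "potential p q x = vector [vector [0, - \<i> * q x], vector [\<i> * p x, 0]]"

definition dirac ::
  "real \<Rightarrow> (real \<Rightarrow> complex) \<Rightarrow> (real \<Rightarrow> complex) \<Rightarrow> (real \<Rightarrow> complex ^ 2) \<Rightarrow> real \<Rightarrow> complex ^ 2" where
  "dirac h p q \<Psi> x =
     (\<i> * of_real h) *s (sigma3 *v vector_derivative \<Psi> (at x)) + potential p q x *v \<Psi> x"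

text \<open>
  Since \<open>vector_derivative\<close> is total, the domain records explicitly that the derivative entering
  \<open>dirac h p q \<Psi>\<close> exists almost everywhere. This excludes nothing: by Lebesgue's theorem every
  locally absolutely continuous function is differentiable almost everywhere.
\<close>

definition dirac_domain ::
  "real \<Rightarrow> (real \<Rightarrow> complex) \<Rightarrow> (real \<Rightarrow> complex) \<Rightarrow> (real \<Rightarrow> complex ^ 2) set" where
  "dirac_domain h p q =
     {\<Psi> \<in> L2. (\<forall>k. (\<lambda>x. \<Psi> x $ k) \<in> AC_loc) \<and> (AE x in lebesgue. \<Psi> differentiable (at x)) \<and>
              dirac h p q \<Psi> \<in> L2}"

text \<open>
  For an operator \<open>T\<close> with domain \<open>D\<close>, \<open>z\<close> is in the resolvent set iff \<open>T - z\<close> is a bijection from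
  \<open>D\<close> onto \<open>L\<^sup>2\<close> (both modulo equality almost everywhere) with bounded inverse.
\<close>

definition L2_resolvent_set ::
  "(real \<Rightarrow> complex ^ 2) set \<Rightarrow> ((real \<Rightarrow> complex ^ 2) \<Rightarrow> real \<Rightarrow> complex ^ 2) \<Rightarrow> complex set" where
  "L2_resolvent_set D T =
     {z. (\<forall>\<Psi>\<in>D. \<forall>\<Phi>\<in>D. (AE x in lebesgue. T \<Psi> x - z *s \<Psi> x = T \<Phi> x - z *s \<Phi> x)
              \<longrightarrow> (AE x in lebesgue. \<Psi> x = \<Phi> x)) \<and>
         (\<forall>F\<in>L2. \<exists>\<Psi>\<in>D. AE x in lebesgue. T \<Psi> x - z *s \<Psi> x = F x) \<and>
         (\<exists>C. \<forall>\<Psi>\<in>D. L2_norm \<Psi> \<le> C * L2_norm (\<lambda>x. T \<Psi> x - z *s \<Psi> x))}"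

definition L2_spectrum ::
  "(real \<Rightarrow> complex ^ 2) set \<Rightarrow> ((real \<Rightarrow> complex ^ 2) \<Rightarrow> real \<Rightarrow> complex ^ 2) \<Rightarrow> complex set" where
  "L2_spectrum D T = - L2_resolvent_set D T"

definition dirac_spectrum ::
  "real \<Rightarrow> (real \<Rightarrow> complex) \<Rightarrow> (real \<Rightarrow> complex) \<Rightarrow> complex set" where
  "dirac_spectrum h p q = L2_spectrum (dirac_domain h p q) (dirac h p q)"

end

theory Submission
  imports Defs
begin

text \<open>
  Let \<open>|Im z|\<^sup>2 > \<parallel>p\<parallel> \<parallel>q\<parallel>\<close>; then \<open>z\<close> lies in the resolvent set, for the following reason. Solved for
  the derivatives, the equation \<open>(\<DD> - z) \<Psi> = F\<close> reads
  \<open>\<Psi>\<^sub>1' = c \<Psi>\<^sub>1 + (q / h) \<Psi>\<^sub>2 + a\<close> and \<open>\<Psi>\<^sub>2' = - c \<Psi>\<^sub>2 + (p / h) \<Psi>\<^sub>1 + b\<close> with \<open>c = - i z / h\<close> and sources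
  \<open>a\<close>, \<open>b\<close> proportional to \<open>F\<^sub>1\<close>, \<open>F\<^sub>2\<close>. As \<open>Re c = Im z / h\<close> is not zero, the scalar equation
  \<open>f' = c f + u\<close> has exactly one square-integrable solution for each square-integrable \<open>u\<close>, the
  convolution of \<open>u\<close> with a one-sided exponential whose \<open>L\<^sup>1\<close> norm is \<open>h / |Im z|\<close>. Inserting the
  solution of the second equation into the first gives a fixed point problem for \<open>\<Psi>\<^sub>1\<close> whose linear
  part has norm at most \<open>(h / |Im z|)\<^sup>2 (\<parallel>q\<parallel> / h) (\<parallel>p\<parallel> / h) = \<parallel>p\<parallel> \<parallel>q\<parallel> / |Im z|\<^sup>2 < 1\<close>.
  So the equation has exactly one solution, and the solution depends boundedly on \<open>F\<close>.

  Three facts about the scalar equation carry this. The lemma \<open>green_op_ODE\<close> says that the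
  convolution solves the equation almost everywhere; it rests on Lebesgue's differentiation theorem.
  Its uniqueness, \<open>sq_integrable_green_op_unique\<close>, rests on the fundamental theorem of calculus
  for absolutely continuous functions. The norm bounds are \<open>Young_green_op\<close> and, for the supremum
  norm, \<open>green_op_AE_bound\<close>. The fixed point is found by iteration in the supremum norm
  (\<open>sq_integrable_fixed_point\<close>), where functions need not be identified modulo null sets; the \<open>L\<^sup>2\<close>
  bound is inherited through Fatou's lemma. For the system this gives \<open>solution_exists\<close>
  (surjectivity) and \<open>a_priori_bound\<close> (injectivity and a bounded inverse).
\<close>

section \<open>Absolutely continuous functions\<close>

lemma abs_cont_on_intervalD:
  assumes "abs_cont_on_interval a b f" "\<epsilon> > 0"
  obtains \<delta> where "\<delta> > 0"
    "\<And>d. d division_of \<Union>d \<Longrightarrow> \<Union>d \<subseteq> {a..b} \<Longrightarrow> (\<Sum>K\<in>d. measure lborel K) < \<delta>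
       \<Longrightarrow> (\<Sum>K\<in>d. cmod (f (Sup K) - f (Inf K))) < \<epsilon>"
  using assms unfolding abs_cont_on_interval_def by metis

lemma division_of_single_interval:
  fixes u v :: real
  assumes "u \<le> v"
  shows "{{u..v}} division_of \<Union>{{u..v}}"
  using division_of_self[of u v] assms by (auto simp: box_real)

lemma abs_cont_on_interval_imp_continuous_on:
  assumes "abs_cont_on_interval a b f"
  shows "continuous_on {a..b} f"
proof (unfold continuous_on_iff, intro ballI allI impI)
  fix x and \<epsilon> :: real
  assume x: "x \<in> {a..b}" and "\<epsilon> > 0"
  obtain \<delta> where "\<delta> > 0" and \<delta>: "\<And>d. d division_of \<Union>d \<Longrightarrow> \<Union>d \<subseteq> {a..b} \<Longrightarrow>
       (\<Sum>K\<in>d. measure lborel K) < \<delta> \<Longrightarrow> (\<Sum>K\<in>d. cmod (f (Sup K) - f (Inf K))) < \<epsilon>"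
    using abs_cont_on_intervalD[OF assms \<open>\<epsilon> > 0\<close>] by blast
  have close: "cmod (f v - f u) < \<epsilon>" if "u \<le> v" "v - u < \<delta>" "u \<in> {a..b}" "v \<in> {a..b}" for u v
    using \<delta>[OF division_of_single_interval[OF that(1)]] that by auto
  have "dist (f y) (f x) < \<epsilon>" if "y \<in> {a..b}" "dist y x < \<delta>" for y
    using close[of x y] close[of y x] that x
    by (cases "x \<le> y") (auto simp: dist_norm norm_minus_commute)
  then show "\<exists>d>0. \<forall>y\<in>{a..b}. dist y x < d \<longrightarrow> dist (f y) (f x) < \<epsilon>"
    using \<open>\<delta> > 0\<close> by blast
qed

lemma division_member_Inf_Sup:
  fixes d :: "real set set"
  assumes "d division_of S" "K \<in> d" "S \<subseteq> {a..b}"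
  shows "K = {Inf K..Sup K}" "Inf K \<le> Sup K" "Inf K \<in> {a..b}" "Sup K \<in> {a..b}" "measure lborel K = Sup K - Inf K"
proof -
  obtain u v where K: "K = {u..v}" "K \<noteq> {}"
    using division_ofD(3,4)[OF assms(1,2)] by auto
  then have "u \<le> v" by auto
  moreover have "K \<subseteq> {a..b}"
    using division_ofD(2)[OF assms(1,2)] assms(3) by blast
  ultimately show "K = {Inf K..Sup K}" "Inf K \<le> Sup K" "Inf K \<in> {a..b}" "Sup K \<in> {a..b}" "measure lborel K = Sup K - Inf K"
    using K by auto
qed

lemma abs_cont_on_interval_diff:
  assumes f: "abs_cont_on_interval a b f" and g: "abs_cont_on_interval a b g"
  shows "abs_cont_on_interval a b (\<lambda>x. f x - g x)"
  unfolding abs_cont_on_interval_def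
proof (intro allI impI)
  fix \<epsilon> :: real
  assume "\<epsilon> > 0"
  then have e2: "\<epsilon> / 2 > 0" by simp
  obtain \<delta>1 where d1: "\<delta>1 > 0" "\<And>d. d division_of \<Union>d \<Longrightarrow> \<Union>d \<subseteq> {a..b} \<Longrightarrow>
       (\<Sum>K\<in>d. measure lborel K) < \<delta>1 \<Longrightarrow> (\<Sum>K\<in>d. cmod (f (Sup K) - f (Inf K))) < \<epsilon> / 2"
    using abs_cont_on_intervalD[OF f e2] by blast
  obtain \<delta>2 where d2: "\<delta>2 > 0" "\<And>d. d division_of \<Union>d \<Longrightarrow> \<Union>d \<subseteq> {a..b} \<Longrightarrow>
       (\<Sum>K\<in>d. measure lborel K) < \<delta>2 \<Longrightarrow> (\<Sum>K\<in>d. cmod (g (Sup K) - g (Inf K))) < \<epsilon> / 2"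
    using abs_cont_on_intervalD[OF g e2] by blast
  show "\<exists>\<delta>>0. \<forall>d. d division_of \<Union>d \<and> \<Union>d \<subseteq> {a..b} \<and> (\<Sum>K\<in>d. measure lborel K) < \<delta>
        \<longrightarrow> (\<Sum>K\<in>d. cmod (f (Sup K) - g (Sup K) - (f (Inf K) - g (Inf K)))) < \<epsilon>"
  proof (intro exI[of _ "min \<delta>1 \<delta>2"] conjI allI impI; (elim conjE)?)
    fix d :: "real set set"
    assume d: "d division_of \<Union>d" "\<Union>d \<subseteq> {a..b}" "(\<Sum>K\<in>d. measure lborel K) < min \<delta>1 \<delta>2"
    have "(\<Sum>K\<in>d. cmod (f (Sup K) - g (Sup K) - (f (Inf K) - g (Inf K))))
      \<le> (\<Sum>K\<in>d. cmod (f (Sup K) - f (Inf K)) + cmod (g (Sup K) - g (Inf K)))"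
      by (intro sum_mono order_trans[OF _ norm_triangle_ineq4]) (simp add: algebra_simps)
    also have "\<dots> < \<epsilon>"
      using d1(2)[of d] d2(2)[of d] d by (simp add: sum.distrib)
    finally show "(\<Sum>K\<in>d. cmod (f (Sup K) - g (Sup K) - (f (Inf K) - g (Inf K)))) < \<epsilon>" .
  qed (use d1 d2 in auto)
qed

lemma abs_cont_on_interval_mult:
  assumes f: "abs_cont_on_interval a b f" and g: "abs_cont_on_interval a b g"
  shows "abs_cont_on_interval a b (\<lambda>x. f x * g x)"
  unfolding abs_cont_on_interval_def
proof (intro allI impI)
  fix \<epsilon> :: real
  assume "\<epsilon> > 0"
  have "bounded (f ` {a..b} \<union> g ` {a..b})"
    by (simp add: compact_imp_bounded[OF compact_continuous_image]
        abs_cont_on_interval_imp_continuous_on[OF f] abs_cont_on_interval_imp_continuous_on[OF g])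
  then obtain M where "M > 0" and M: "\<And>x. x \<in> {a..b} \<Longrightarrow> cmod (f x) \<le> M \<and> cmod (g x) \<le> M"
    unfolding bounded_pos by blast
  have e2: "\<epsilon> / (2 * M) > 0" using \<open>\<epsilon> > 0\<close> \<open>M > 0\<close> by simp
  obtain \<delta>1 where d1: "\<delta>1 > 0" "\<And>d. d division_of \<Union>d \<Longrightarrow> \<Union>d \<subseteq> {a..b} \<Longrightarrow>
       (\<Sum>K\<in>d. measure lborel K) < \<delta>1 \<Longrightarrow> (\<Sum>K\<in>d. cmod (f (Sup K) - f (Inf K))) < \<epsilon> / (2 * M)"
    using abs_cont_on_intervalD[OF f e2] by blast
  obtain \<delta>2 where d2: "\<delta>2 > 0" "\<And>d. d division_of \<Union>d \<Longrightarrow> \<Union>d \<subseteq> {a..b} \<Longrightarrow>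
       (\<Sum>K\<in>d. measure lborel K) < \<delta>2 \<Longrightarrow> (\<Sum>K\<in>d. cmod (g (Sup K) - g (Inf K))) < \<epsilon> / (2 * M)"
    using abs_cont_on_intervalD[OF g e2] by blast
  show "\<exists>\<delta>>0. \<forall>d. d division_of \<Union>d \<and> \<Union>d \<subseteq> {a..b} \<and> (\<Sum>K\<in>d. measure lborel K) < \<delta>
        \<longrightarrow> (\<Sum>K\<in>d. cmod (f (Sup K) * g (Sup K) - f (Inf K) * g (Inf K))) < \<epsilon>"
  proof (intro exI[of _ "min \<delta>1 \<delta>2"] conjI allI impI; (elim conjE)?)
    fix d :: "real set set"
    assume d: "d division_of \<Union>d" "\<Union>d \<subseteq> {a..b}" "(\<Sum>K\<in>d. measure lborel K) < min \<delta>1 \<delta>2"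
    have "(\<Sum>K\<in>d. cmod (f (Sup K) * g (Sup K) - f (Inf K) * g (Inf K)))
      \<le> (\<Sum>K\<in>d. M * cmod (f (Sup K) - f (Inf K)) + M * cmod (g (Sup K) - g (Inf K)))"
    proof (rule sum_mono)
      fix K assume K: "K \<in> d"
      have "f (Sup K) * g (Sup K) - f (Inf K) * g (Inf K)
        = (f (Sup K) - f (Inf K)) * g (Sup K) + f (Inf K) * (g (Sup K) - g (Inf K))"
        by (simp add: algebra_simps)
      also have "cmod \<dots> \<le> cmod (f (Sup K) - f (Inf K)) * cmod (g (Sup K)) + cmod (f (Inf K)) * cmod (g (Sup K) - g (Inf K))"
        by (metis norm_mult norm_triangle_ineq)
      also have "\<dots> \<le> cmod (f (Sup K) - f (Inf K)) * M + M * cmod (g (Sup K) - g (Inf K))"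
        using M[OF division_member_Inf_Sup(3)[OF d(1) K d(2)]] M[OF division_member_Inf_Sup(4)[OF d(1) K d(2)]]
        by (intro add_mono mult_left_mono mult_right_mono) auto
      finally show "cmod (f (Sup K) * g (Sup K) - f (Inf K) * g (Inf K))
        \<le> M * cmod (f (Sup K) - f (Inf K)) + M * cmod (g (Sup K) - g (Inf K))"
        by (simp add: mult.commute)
    qed
    also have "\<dots> = M * ((\<Sum>K\<in>d. cmod (f (Sup K) - f (Inf K))) + (\<Sum>K\<in>d. cmod (g (Sup K) - g (Inf K))))"
      by (simp add: sum.distrib sum_distrib_left distrib_left)
    also have "\<dots> < M * (\<epsilon> / (2 * M) + \<epsilon> / (2 * M))"
      using d1(2)[of d] d2(2)[of d] d \<open>M > 0\<close> by (intro mult_strict_left_mono add_strict_mono) auto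
    also have "\<dots> = \<epsilon>"
      using \<open>M > 0\<close> by simp
    finally show "(\<Sum>K\<in>d. cmod (f (Sup K) * g (Sup K) - f (Inf K) * g (Inf K))) < \<epsilon>" .
  qed (use d1 d2 in auto)
qed

lemma Lipschitz_imp_abs_cont_on_interval:
  assumes "L > 0" and L: "\<And>x y. x \<in> {a..b} \<Longrightarrow> y \<in> {a..b} \<Longrightarrow> cmod (f y - f x) \<le> L * \<bar>y - x\<bar>"
  shows "abs_cont_on_interval a b f"
  unfolding abs_cont_on_interval_def
proof (intro allI impI)
  fix \<epsilon> :: real
  assume "\<epsilon> > 0"
  show "\<exists>\<delta>>0. \<forall>d. d division_of \<Union>d \<and> \<Union>d \<subseteq> {a..b} \<and> (\<Sum>K\<in>d. measure lborel K) < \<delta>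
        \<longrightarrow> (\<Sum>K\<in>d. cmod (f (Sup K) - f (Inf K))) < \<epsilon>"
  proof (intro exI[of _ "\<epsilon> / L"] conjI allI impI; (elim conjE)?)
    fix d :: "real set set"
    assume d: "d division_of \<Union>d" "\<Union>d \<subseteq> {a..b}" "(\<Sum>K\<in>d. measure lborel K) < \<epsilon> / L"
    have "(\<Sum>K\<in>d. cmod (f (Sup K) - f (Inf K))) \<le> (\<Sum>K\<in>d. L * measure lborel K)"
    proof (rule sum_mono)
      fix K assume "K \<in> d"
      from division_member_Inf_Sup(2-5)[OF d(1) this d(2)]
      show "cmod (f (Sup K) - f (Inf K)) \<le> L * measure lborel K"
        using L[of "Inf K" "Sup K"] by simp
    qed
    also have "\<dots> < \<epsilon>"
      using d(3) \<open>L > 0\<close> by (simp add: sum_distrib_left[symmetric] field_simps)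
    finally show "(\<Sum>K\<in>d. cmod (f (Sup K) - f (Inf K))) < \<epsilon>" .
  qed (use \<open>\<epsilon> > 0\<close> \<open>L > 0\<close> in auto)
qed

text \<open>
  Exponentials are the integrating factors that turn \<open>f' = c f + u\<close> into a pure integration.
\<close>

lemma abs_cont_on_interval_exp:
  "abs_cont_on_interval a b (\<lambda>x. exp (c * of_real x))"
proof -
  define L where "L = cmod c * exp (cmod c * max \<bar>a\<bar> \<bar>b\<bar>) + 1"
  have "cmod (exp (c * of_real y) - exp (c * of_real x)) \<le> L * \<bar>y - x\<bar>"
    if "x \<in> {a..b}" "y \<in> {a..b}" for x y
  proof -
    have "norm (exp (c * of_real y) - exp (c * of_real x)) \<le> L * norm (y - x)"
    proof (rule differentiable_bound[of "{a..b}"])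
      fix t assume t: "t \<in> {a..b}"
      have "((\<lambda>x. exp (c * of_real x)) has_vector_derivative c * exp (c * of_real t)) (at t within {a..b})"
        by (rule has_vector_derivative_real_field[of "\<lambda>z. exp (c * z)"])
          (auto intro!: derivative_eq_intros)
      then show "((\<lambda>x. exp (c * of_real x)) has_derivative (\<lambda>u. u *\<^sub>R (c * exp (c * of_real t)))) (at t within {a..b})"
        by (simp add: has_vector_derivative_def)
      have "cmod (exp (c * of_real t)) \<le> exp (cmod (c * of_real t))"
        by (rule norm_exp)
      also have "\<dots> \<le> exp (cmod c * max \<bar>a\<bar> \<bar>b\<bar>)"
        using t by (auto simp: norm_mult intro!: mult_left_mono)
      finally have "cmod c * cmod (exp (c * of_real t)) \<le> cmod c * exp (cmod c * max \<bar>a\<bar> \<bar>b\<bar>)"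
        by (rule mult_left_mono) simp
      then have "cmod c * cmod (exp (c * of_real t)) \<le> L"
        unfolding L_def by linarith
      then show "onorm (\<lambda>u. u *\<^sub>R (c * exp (c * of_real t))) \<le> L"
        by (intro onorm_le) (simp add: norm_mult mult_left_mono mult.commute[of L])
    qed (use that in auto)
    then show ?thesis by simp
  qed
  moreover have "L > 0"
    unfolding L_def by (simp add: add_nonneg_pos)
  ultimately show ?thesis
    by (intro Lipschitz_imp_abs_cont_on_interval) auto
qed

text \<open>
  The derivative may fail to exist on a null set \<open>N\<close>, so the usual Henstock-Kurzweil argument is
  split according to the tag of each interval. At tags outside \<open>N\<close> the gauge comes from
  differentiability, and the increment of \<open>f\<close> is close to the length times the derivative. At tags
  in \<open>N\<close> the gauge confines the interval to an open set \<open>U \<supseteq> N\<close> of measure below the \<open>\<delta>\<close> of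
  absolute continuity, so that the increments of \<open>f\<close> over all those intervals together are small;
  the integrand is set to \<open>0\<close> on \<open>N\<close>, which does not change its integral.
\<close>

lemma fundamental_theorem_of_calculus_abs_cont:
  fixes f f' :: "real \<Rightarrow> complex"
  assumes "a \<le> b" and ac: "abs_cont_on_interval a b f"
    and deriv: "AE x in lebesgue. (f has_vector_derivative f' x) (at x)"
  shows "(f' has_integral (f b - f a)) {a..b}"
proof -
  obtain N where N: "N \<in> null_sets lebesgue" "\<And>x. x \<notin> N \<Longrightarrow> (f has_vector_derivative f' x) (at x)"
    using AE_E3[OF deriv] by auto
  define g where "g x = (if x \<in> N then 0 else f' x)" for x
  have "(g has_integral (f b - f a)) {a..b}"
    unfolding has_integral_real
  proof (intro allI impI)
    fix e :: real
    assume "e > 0"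
    \<comment> \<open>Half of the error is spent on each kind of tag; the \<open>+ 1\<close> covers the case a = b.\<close>
    define e1 where "e1 = e / (2 * (b - a + 1))"
    have "e1 > 0" "e1 * (b - a) < e / 2"
      using \<open>e > 0\<close> \<open>a \<le> b\<close> by (auto simp: e1_def field_simps)
    obtain \<delta> where "\<delta> > 0" and \<delta>: "\<And>d. d division_of \<Union>d \<Longrightarrow> \<Union>d \<subseteq> {a..b} \<Longrightarrow>
         (\<Sum>K\<in>d. measure lborel K) < \<delta> \<Longrightarrow> (\<Sum>K\<in>d. cmod (f (Sup K) - f (Inf K))) < e / 2"
      using abs_cont_on_intervalD[OF ac, of "e / 2"] half_gt_zero[OF \<open>e > 0\<close>] by blast
    obtain U where U: "open U" "N \<subseteq> U" "U - N \<in> lmeasurable" "emeasure lebesgue (U - N) < ennreal \<delta>"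
      using sets_lebesgue_outer_open[OF _ \<open>\<delta> > 0\<close>, of N] N(1) by (auto simp: null_sets_def)
    have "emeasure lebesgue U = emeasure lebesgue (U - N)"
      using emeasure_Diff_null_set[of N lebesgue U] N(1) \<open>open U\<close> by auto
    then have emU: "emeasure lebesgue U < ennreal \<delta>"
      using U(4) by simp
    have lmU: "U \<in> lmeasurable" 
      using emU \<open>open U\<close> by (intro fmeasurableI) (auto intro: order_less_le_trans simp: less_top[symmetric])
    have mU: "measure lebesgue U < \<delta>"
      using emU \<open>\<delta> > 0\<close> lmU by (simp add: emeasure_eq_measure2 ennreal_less_iff)
    have "\<forall>x. \<exists>d>0. x \<notin> N \<longrightarrow> (\<forall>y. norm (y - x) < d \<longrightarrow> norm (f y - f x - (y - x) *\<^sub>R f' x) \<le> e1 * norm (y - x))"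
      using N(2)[unfolded has_vector_derivative_def has_derivative_at_alt] \<open>e1 > 0\<close>
      by (metis zero_less_one)
    then obtain d where d: "\<And>x. d x > 0" "\<And>x y. x \<notin> N \<Longrightarrow> norm (y - x) < d x \<Longrightarrow>
        norm (f y - f x - (y - x) *\<^sub>R f' x) \<le> e1 * norm (y - x)"
      by metis
    define \<gamma> where "\<gamma> x = (if x \<in> N then U else ball x (d x))" for x
    show "\<exists>\<gamma>. gauge \<gamma> \<and> (\<forall>p. p tagged_division_of {a..b} \<and> \<gamma> fine p \<longrightarrow>
        norm ((\<Sum>(x,K)\<in>p. measure lborel K *\<^sub>R g x) - (f b - f a)) < e)"
    proof (intro exI[of _ \<gamma>] conjI allI impI; (elim conjE)?)
      show "gauge \<gamma>"
        using U d(1) by (auto simp: gauge_def \<gamma>_def)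
      fix p
      assume p: "p tagged_division_of {a..b}" and fine: "\<gamma> fine p"
      have finp: "finite p" using p by blast
      define pN where "pN = {xK \<in> p. fst xK \<in> N}"
      have pN: "pN \<subseteq> p" by (auto simp: pN_def)
      let ?t = "\<lambda>x K. measure lborel K *\<^sub>R g x - (f (Sup K) - f (Inf K))"
      have ba: "b - a = (\<Sum>(x,K)\<in>p. Sup K - Inf K)" "f b - f a = (\<Sum>(x,K)\<in>p. f (Sup K) - f (Inf K))"
        using additive_tagged_division_1[of a b p "\<lambda>x. x"] additive_tagged_division_1[of a b p f]
          \<open>a \<le> b\<close> p by auto
      have K: "\<exists>u v. u \<le> v \<and> K = {u..v} \<and> x \<in> {u..v} \<and> a \<le> u \<and> v \<le> b" if "(x, K) \<in> p" for x K
        using tagged_division_ofD(2,3,4)[OF p that] by (force simp: box_real)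
      have "norm ((\<Sum>(x,K)\<in>p. measure lborel K *\<^sub>R g x) - (f b - f a)) = norm (\<Sum>(x,K)\<in>p. ?t x K)"
        unfolding ba(2) by (simp add: sum_subtractf split_def)
      also have "\<dots> \<le> (\<Sum>(x,K)\<in>p. norm (?t x K))"
        by (rule order_trans[OF norm_sum]) (simp add: split_def)
      also have "\<dots> = (\<Sum>(x,K)\<in>p - pN. norm (?t x K)) + (\<Sum>(x,K)\<in>pN. norm (?t x K))"
        using sum.subset_diff[OF pN finp] by blast
      also have "(\<Sum>(x,K)\<in>p - pN. norm (?t x K)) \<le> (\<Sum>(x,K)\<in>p - pN. e1 * (Sup K - Inf K))"
      proof (rule sum_mono, clarify)
        fix x K assume xK: "(x, K) \<in> p" "(x, K) \<notin> pN"
        then have xN: "x \<notin> N" by (auto simp: pN_def)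
        obtain u v where uv: "u \<le> v" "K = {u..v}" "x \<in> {u..v}" using K[OF xK(1)] by blast
        have sub: "K \<subseteq> ball x (d x)"
          using fine xK(1) xN unfolding fine_def \<gamma>_def by (smt (verit, best) case_prodD)
        have uends: "u \<in> ball x (d x)" "v \<in> ball x (d x)"
          by (rule subsetD[OF sub], use uv in simp)+
        have "norm (?t x K) = norm (f u - f x - (u - x) *\<^sub>R f' x - (f v - f x - (v - x) *\<^sub>R f' x))"
          using uv xN by (auto simp: g_def algebra_simps)
        also have "\<dots> \<le> norm (f u - f x - (u - x) *\<^sub>R f' x) + norm (f v - f x - (v - x) *\<^sub>R f' x)"
          by (rule norm_triangle_ineq4)
        also have "\<dots> \<le> e1 * norm (u - x) + e1 * norm (v - x)"
          using uends by (intro add_mono d(2) xN) (auto simp: dist_real_def)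
        also have "\<dots> = e1 * (Sup K - Inf K)"
          using uv by (auto simp: algebra_simps)
        finally show "norm (?t x K) \<le> e1 * (Sup K - Inf K)" .
      qed
      also have "\<dots> \<le> (\<Sum>(x,K)\<in>p. e1 * (Sup K - Inf K))"
        using K \<open>e1 > 0\<close> by (intro sum_mono2 finp) fastforce+
      also have "\<dots> = e1 * (b - a)"
        unfolding ba(1) by (simp add: sum_distrib_left split_def)
      also have "\<dots> < e / 2" by fact
      also have "(\<Sum>(x,K)\<in>pN. norm (?t x K)) < e / 2"
      proof -
        define D where "D = snd ` pN"
        have "snd ` p division_of {a..b}"
          using division_of_tagged_division[OF p] .
        then have div: "D division_of \<Union>D" and Dab: "\<Union>D \<subseteq> {a..b}"
          unfolding D_def using pN by (auto intro: division_of_subset[of "snd ` p"] image_mono dest: division_ofD(6))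
        have tag: "pN tagged_division_of \<Union>D"
          using tagged_partial_division_of_Union_self[OF tagged_partial_division_subset[OF _ pN]] p
          unfolding D_def tagged_division_of_def by blast
        \<comment> \<open>A degenerate interval may occur with several tags, so passing from the tagged sum to a sum
          over the intervals needs a summand that vanishes on every interval with empty interior,
          the empty one included, where \<open>Sup\<close> and \<open>Inf\<close> are arbitrary.\<close>
        define w where "w K = (if K = {} then 0 else norm (f (Sup K) - f (Inf K)))" for K
        have "(\<Sum>(x,K)\<in>pN. norm (?t x K)) = (\<Sum>(x,K)\<in>pN. w K)"
        proof (rule sum.cong[OF refl], clarify)
          fix x K assume "(x, K) \<in> pN"
          then show "norm (?t x K) = w K"
            using K[of x K] unfolding pN_def g_def w_def by (auto simp: norm_minus_commute)
        qed
        also have "\<dots> = (\<Sum>K\<in>D. w K)"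
          unfolding D_def
          by (rule sum.over_tagged_division_lemma[OF tag]) (auto simp: w_def)
        also have "\<dots> = (\<Sum>K\<in>D. norm (f (Sup K) - f (Inf K)))"
          using division_ofD(3)[OF div] by (auto simp: w_def intro!: sum.cong)
        also have "\<dots> < e / 2"
        proof (rule \<delta>[OF div Dab])
          have "(\<Sum>K\<in>D. measure lborel K) = (\<Sum>K\<in>D. measure lebesgue K)"
            using division_ofD(4)[OF div] by (intro sum.cong) fastforce+
          also have "\<dots> = measure lebesgue (\<Union>D)"
            by (rule content_division[OF div])
          also have "\<dots> \<le> measure lebesgue U"
          proof (rule measure_mono_fmeasurable[OF _ _ lmU])
            show "\<Union>D \<subseteq> U"
              using fine unfolding D_def pN_def fine_def \<gamma>_def by force
            show "\<Union>D \<in> sets lebesgue"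
              using lmeasurable_division[OF div] by blast
          qed
          also note mU
          finally show "(\<Sum>K\<in>D. measure lborel K) < \<delta>" .
        qed
        finally show ?thesis .
      qed
      finally show "norm ((\<Sum>(x,K)\<in>p. measure lborel K *\<^sub>R g x) - (f b - f a)) < e"
        by simp
    qed
  qed
  then show ?thesis
    using N(1) by (elim has_integral_spike[rotated 2]) (auto simp: g_def negligible_iff_null_sets)
qed

section \<open>Indefinite integrals of square-integrable functions\<close>

text \<open>
  This elementary inequality replaces Cauchy-Schwarz wherever only an \<open>L\<^sup>2\<close> bound on the integrand
  is known: integrating it over a set of small measure makes both terms small for a suitable \<open>r\<close>.
\<close>

lemma le_inverse_plus_square:
  fixes y r :: real
  assumes "r > 0"
  shows "y \<le> 1 / (4 * r) + r * y\<^sup>2"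
proof -
  have "0 \<le> (1 - 2 * r * y)\<^sup>2" by simp
  then have "4 * r * y \<le> 1 + 4 * r * (r * y\<^sup>2)"
    by (simp add: power2_eq_square algebra_simps)
  then show ?thesis
    using assms by (simp add: field_simps)
qed

lemma set_integrable_of_square:
  fixes v :: "real \<Rightarrow> complex"
  assumes v: "v \<in> borel_measurable lebesgue"
    and sq: "set_integrable lebesgue {a..b} (\<lambda>x. (cmod (v x))\<^sup>2)"
  shows "set_integrable lebesgue {a..b} v"
proof -
  have "set_integrable lebesgue {a..b} (\<lambda>x. 1 / 4 + (cmod (v x))\<^sup>2)"
    using sq by (intro set_integral_add) (auto simp: absolutely_integrable_on_const)
  then show ?thesis
    unfolding set_integrable_def
  proof (rule Bochner_Integration.integrable_bound)
    show "AE x in lebesgue. norm (indicat_real {a..b} x *\<^sub>R v x) \<le> norm (indicat_real {a..b} x *\<^sub>R (1 / 4 + (cmod (v x))\<^sup>2))"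
      using le_inverse_plus_square[of 1] by (auto simp: indicator_def)
    show "(\<lambda>x. indicat_real {a..b} x *\<^sub>R v x) \<in> borel_measurable lebesgue"
      by (intro borel_measurable_scaleR borel_measurable_indicator v) auto
  qed
qed

lemma abs_cont_indefinite_integral:
  fixes v :: "real \<Rightarrow> complex"
  assumes v: "v \<in> borel_measurable lebesgue"
    and sq: "set_integrable lebesgue {a..b} (\<lambda>x. (cmod (v x))\<^sup>2)"
  shows "abs_cont_on_interval a b (\<lambda>x. integral {a..x} v)"
  unfolding abs_cont_on_interval_def
proof (intro allI impI)
  fix \<epsilon> :: real
  assume "\<epsilon> > 0"
  have vi: "v integrable_on {a..b}" and avi: "(\<lambda>x. cmod (v x)) integrable_on {a..b}"
    using set_integrable_of_square[OF assms] unfolding absolutely_integrable_on_def by auto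
  have sqi: "(\<lambda>x. (cmod (v x))\<^sup>2) integrable_on {a..b}"
    using set_lebesgue_integral_eq_integral[OF sq] by blast
  define I where "I = integral {a..b} (\<lambda>x. (cmod (v x))\<^sup>2)"
  have "I \<ge> 0"
    unfolding I_def by (intro integral_nonneg sqi) auto
  \<comment> \<open>The weight \<open>r\<close> makes the quadratic term at most \<open>\<epsilon>/2\<close>; total length below \<open>2 r \<epsilon>\<close> then
    does the same for the term \<open>1 / (4 r)\<close> per unit length.\<close>
  define r where "r = \<epsilon> / (2 * (I + 1))"
  have "r > 0" "r * I < \<epsilon> / 2"
    using \<open>\<epsilon> > 0\<close> \<open>I \<ge> 0\<close> by (auto simp: r_def field_simps)
  show "\<exists>\<delta>>0. \<forall>d. d division_of \<Union>d \<and> \<Union>d \<subseteq> {a..b} \<and> (\<Sum>K\<in>d. measure lborel K) < \<delta>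
        \<longrightarrow> (\<Sum>K\<in>d. cmod (integral {a..Sup K} v - integral {a..Inf K} v)) < \<epsilon>"
  proof (intro exI[of _ "2 * r * \<epsilon>"] conjI allI impI; (elim conjE)?)
    fix d :: "real set set"
    assume d: "d division_of \<Union>d" "\<Union>d \<subseteq> {a..b}" "(\<Sum>K\<in>d. measure lborel K) < 2 * r * \<epsilon>"
    note K = division_member_Inf_Sup[OF d(1) _ d(2)]
    have "cmod (integral {a..Sup K} v - integral {a..Inf K} v)
        \<le> measure lborel K * (1 / (4 * r)) + r * integral K (\<lambda>x. (cmod (v x))\<^sup>2)" if "K \<in> d" for K
    proof -
      define s t where "s = Inf K" and "t = Sup K"
      have st: "K = {s..t}" "s \<le> t" "a \<le> s" "t \<le> b"
        unfolding s_def t_def using K(2-4)[OF that] by (simp_all flip: K(1)[OF that])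
      have sub: "{s..t} \<subseteq> {a..b}" using st by auto
      have i1: "v integrable_on {s..t}" "(\<lambda>x. (cmod (v x))\<^sup>2) integrable_on {s..t}" "v integrable_on {a..t}"
        using integrable_on_subinterval[OF vi] integrable_on_subinterval[OF sqi] st by auto
      have "integral {a..s} v + integral {s..t} v = integral {a..t} v"
        by (rule Henstock_Kurzweil_Integration.integral_combine) (use st i1 in auto)
      then have "integral {a..t} v - integral {a..s} v = integral {s..t} v"
        by (simp add: algebra_simps)
      also have "cmod \<dots> \<le> integral {s..t} (\<lambda>x. 1 / (4 * r) + r * (cmod (v x))\<^sup>2)"
        using le_inverse_plus_square[OF \<open>r > 0\<close>] i1
        by (intro integral_norm_bound_integral integrable_add integrable_const_ivl integrable_on_mult_right) auto
      also have "\<dots> = integral {s..t} (\<lambda>x. 1 / (4 * r)) + integral {s..t} (\<lambda>x. r * (cmod (v x))\<^sup>2)"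
        using i1 by (intro Henstock_Kurzweil_Integration.integral_add integrable_const_ivl integrable_on_mult_right) auto
      also have "\<dots> = (t - s) * (1 / (4 * r)) + r * integral {s..t} (\<lambda>x. (cmod (v x))\<^sup>2)"
        using st by simp
      finally have le: "cmod (integral {a..t} v - integral {a..s} v)
          \<le> (t - s) * (1 / (4 * r)) + r * integral {s..t} (\<lambda>x. (cmod (v x))\<^sup>2)" .
      have "measure lborel K = t - s"
        using K(5)[OF that] by (simp add: s_def t_def)
      from le[folded this st(1)] show ?thesis
        unfolding s_def t_def .
    qed
    then have "(\<Sum>K\<in>d. cmod (integral {a..Sup K} v - integral {a..Inf K} v))
      \<le> (\<Sum>K\<in>d. measure lborel K * (1 / (4 * r)) + r * integral K (\<lambda>x. (cmod (v x))\<^sup>2))"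
      by (rule sum_mono)
    also have "\<dots> = (\<Sum>K\<in>d. measure lborel K) * (1 / (4 * r)) + r * (\<Sum>K\<in>d. integral K (\<lambda>x. (cmod (v x))\<^sup>2))"
      by (simp only: sum.distrib sum_distrib_left sum_distrib_right)
    also have "(\<Sum>K\<in>d. integral K (\<lambda>x. (cmod (v x))\<^sup>2)) = integral (\<Union>d) (\<lambda>x. (cmod (v x))\<^sup>2)"
    proof (rule integral_combine_division_bottomup[OF d(1), symmetric])
      fix K assume "K \<in> d"
      then have sub: "{Inf K..Sup K} \<subseteq> {a..b}"
        using K(3,4)[of K] by auto
      show "(\<lambda>x. (cmod (v x))\<^sup>2) integrable_on K"
        by (subst K(1)[OF \<open>K \<in> d\<close>]) (rule integrable_on_subinterval[OF sqi sub])
    qed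
    also have "integral (\<Union>d) (\<lambda>x. (cmod (v x))\<^sup>2) \<le> I"
    proof -
      have "(\<lambda>x. (cmod (v x))\<^sup>2) integrable_on \<Union>d"
        by (rule integrable_on_subdivision[OF d(1) sqi d(2)])
      then show ?thesis
        unfolding I_def using d(2) sqi by (intro integral_subset_le) auto
    qed
    also have "(\<Sum>K\<in>d. measure lborel K) * (1 / (4 * r)) + r * I < \<epsilon>"
    proof -
      have "(\<Sum>K\<in>d. measure lborel K) * (1 / (4 * r)) < (2 * r * \<epsilon>) * (1 / (4 * r))"
        using d(3) \<open>r > 0\<close> by (intro mult_strict_right_mono) auto
      also have "\<dots> = \<epsilon> / 2" using \<open>r > 0\<close> by simp
      finally show ?thesis using \<open>r * I < \<epsilon> / 2\<close> by simp
    qed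
    finally show "(\<Sum>K\<in>d. cmod (integral {a..Sup K} v - integral {a..Inf K} v)) < \<epsilon>"
      using \<open>r > 0\<close> by simp
  qed (use \<open>r > 0\<close> \<open>\<epsilon> > 0\<close> in auto)
qed

lemma AE_right_derivative_indefinite_integral:
  fixes v :: "real \<Rightarrow> complex"
  assumes v: "\<And>a b. v integrable_on {a..b}"
  shows "\<exists>N. negligible N \<and> (\<forall>x e. x \<notin> N \<longrightarrow> 0 < e \<longrightarrow>
      (\<exists>d>0. \<forall>h. 0 < h \<and> h < d \<longrightarrow> norm (integral {x..x + h} v /\<^sub>R h - v x) < e))"
proof (rule integrable_ccontinuous_explicit[of v])
  show "v integrable_on cbox a b" for a b
    using v by simp
  fix N
  assume N: "negligible N" "\<And>x e. x \<notin> N \<Longrightarrow> 0 < e \<Longrightarrow>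
      \<exists>d>0. \<forall>h. 0 < h \<and> h < d \<longrightarrow>
        norm (integral (cbox x (x + h *\<^sub>R One)) v /\<^sub>R h ^ DIM(real) - v x) < e"
  show ?thesis
    using N by (intro exI[of _ N]) simp
qed

text \<open>
  Lebesgue's differentiation theorem on the line. The right derivative is taken from the one-sided
  result applied to \<open>v\<close>, the left derivative from the same result applied to the reflection
  \<open>y \<mapsto> v (- y)\<close>. The exceptional set must not depend on the base point \<open>a\<close>, because later the base
  point is chosen after \<open>x\<close>.
\<close>

lemma AE_has_vector_derivative_indefinite_integral:
  fixes v :: "real \<Rightarrow> complex"
  assumes v: "\<And>a b. v integrable_on {a..b}"
  shows "AE x in lebesgue. \<forall>a<x. ((\<lambda>t. integral {a..t} v) has_vector_derivative v x) (at x)"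
proof -
  obtain N where N: "negligible N" "\<And>x e. x \<notin> N \<Longrightarrow> 0 < e \<Longrightarrow>
      \<exists>d>0. \<forall>h. 0 < h \<and> h < d \<longrightarrow> norm (integral {x..x + h} v /\<^sub>R h - v x) < e"
    using AE_right_derivative_indefinite_integral[OF v] by blast
  have v': "(\<lambda>y. v (- y)) integrable_on {a..b}" for a b
    using Henstock_Kurzweil_Integration.integrable_reflect_real[where f = v and a = "- b" and b = "- a"] v by simp
  obtain N' where N': "negligible N'" "\<And>x e. x \<notin> N' \<Longrightarrow> 0 < e \<Longrightarrow>
      \<exists>d>0. \<forall>h. 0 < h \<and> h < d \<longrightarrow> norm (integral {x..x + h} (\<lambda>y. v (- y)) /\<^sub>R h - v (- x)) < e"
    using AE_right_derivative_indefinite_integral[OF v'] by blast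
  have "negligible (uminus ` N')"
    by (rule negligible_differentiable_image_negligible[OF _ N'(1)])
      (simp_all add: linear_imp_differentiable_on linear_uminus)
  then have "negligible (N \<union> uminus ` N')"
    using N(1) by simp
  moreover have deriv: "\<forall>a<x. ((\<lambda>t. integral {a..t} v) has_vector_derivative v x) (at x)"
    if "x \<notin> N \<union> uminus ` N'" for x
  proof (intro allI impI)
    fix a assume "a < x"
    have xN': "- x \<notin> N'" using that by force
    show "((\<lambda>t. integral {a..t} v) has_vector_derivative v x) (at x)"
      unfolding has_vector_derivative_def has_derivative_at_alt
    proof (intro conjI allI impI)
      fix e :: real assume "e > 0"
      have xN: "x \<notin> N" using that by simp
      from N(2)[OF xN \<open>e > 0\<close>]
      obtain d1 where d1: "d1 > 0" "\<And>h. 0 < h \<Longrightarrow> h < d1 \<Longrightarrow> norm (integral {x..x + h} v /\<^sub>R h - v x) < e"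
        by blast
      obtain d2 where d2: "d2 > 0" "\<And>h. 0 < h \<Longrightarrow> h < d2 \<Longrightarrow> norm (integral {-x..-x + h} (\<lambda>y. v (- y)) /\<^sub>R h - v x) < e"
        using N'(2)[OF xN' \<open>e > 0\<close>] unfolding minus_minus by blast
      have scale: "norm (I - h *\<^sub>R v x) \<le> e * h" if "0 < h" "norm (I /\<^sub>R h - v x) < e" for I and h :: real
      proof -
        have "I - h *\<^sub>R v x = h *\<^sub>R (I /\<^sub>R h - v x)"
          using that(1) by (simp add: scaleR_diff_right)
        also have "norm \<dots> = h * norm (I /\<^sub>R h - v x)"
          using that(1) by simp
        finally show ?thesis using that by (simp add: mult.commute mult_left_mono)
      qed
      have combine: "integral {a..s} v + integral {s..t} v = integral {a..t} v" if "a \<le> s" "s \<le> t" for s t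
        by (rule Henstock_Kurzweil_Integration.integral_combine[OF that v])
      have "norm (integral {a..y} v - integral {a..x} v - (y - x) *\<^sub>R v x) \<le> e * norm (y - x)"
        if y: "norm (y - x) < min (min d1 d2) (x - a)" for y
      proof (cases y x rule: linorder_cases)
        case greater
        have "norm (integral {x..y} v - (y - x) *\<^sub>R v x) \<le> e * (y - x)"
          using d1(2)[of "y - x"] greater y by (intro scale) auto
        moreover have "integral {a..y} v - integral {a..x} v = integral {x..y} v"
          using combine[of x y] greater \<open>a < x\<close> by (simp add: algebra_simps)
        ultimately show ?thesis using greater by simp
      next
        case less
        have eq: "integral {-x..-y} (\<lambda>t. v (- t)) = integral {y..x} v"
          by (rule Henstock_Kurzweil_Integration.integral_reflect_real)
        have "norm (integral {y..x} v - (x - y) *\<^sub>R v x) \<le> e * (x - y)"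
          using d2(2)[of "x - y"] less y eq by (intro scale) auto
        moreover have "integral {a..y} v + integral {y..x} v = integral {a..x} v"
          using less y by (intro combine) auto
        then have "integral {a..y} v - integral {a..x} v - (y - x) *\<^sub>R v x
            = - (integral {y..x} v - (x - y) *\<^sub>R v x)"
          by (simp add: algebra_simps)
        ultimately show ?thesis using less
          by (simp only: norm_minus_cancel) simp
      qed auto
      then show "\<exists>d>0. \<forall>y. norm (y - x) < d \<longrightarrow>
          norm (integral {a..y} v - integral {a..x} v - (y - x) *\<^sub>R v x) \<le> e * norm (y - x)"
        using d1(1) d2(1) \<open>a < x\<close>
        by (intro exI[of _ "min (min d1 d2) (x - a)"] conjI allI impI) (simp, assumption)
    qed (rule bounded_linear_scaleR_left)
  qed
  ultimately have null: "N \<union> uminus ` N' \<in> null_sets lebesgue"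
    by (simp only: negligible_iff_null_sets)
  show ?thesis
    by (rule AE_I'[OF null]) (use deriv in blast)
qed

section \<open>Square-integrable scalar functions\<close>

definition sqnorm :: "(real \<Rightarrow> complex) \<Rightarrow> ennreal" where
  "sqnorm f = (\<integral>\<^sup>+x. ennreal ((cmod (f x))\<^sup>2) \<partial>lebesgue)"

definition sq_integrable :: "(real \<Rightarrow> complex) set" where
  "sq_integrable = {f \<in> borel_measurable lebesgue. sqnorm f < \<infinity>}"

lemma sq_integrableD:
  assumes "f \<in> sq_integrable"
  shows "f \<in> borel_measurable lebesgue" "integrable lebesgue (\<lambda>x. (cmod (f x))\<^sup>2)"
    "sqnorm f = ennreal (LINT x|lebesgue. (cmod (f x))\<^sup>2)"
proof -
  show m: "f \<in> borel_measurable lebesgue"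
    using assms by (simp add: sq_integrable_def)
  then show i: "integrable lebesgue (\<lambda>x. (cmod (f x))\<^sup>2)"
    using assms by (intro integrableI_bounded) (auto simp: sq_integrable_def sqnorm_def)
  show "sqnorm f = ennreal (LINT x|lebesgue. (cmod (f x))\<^sup>2)"
    unfolding sqnorm_def by (rule nn_integral_eq_integral[OF i]) simp
qed

lemma sqnorm_AE_mono:
  assumes "AE x in lebesgue. cmod (f x) \<le> B * cmod (g x)" "B \<ge> 0" and g: "g \<in> borel_measurable lebesgue"
  shows "sqnorm f \<le> ennreal (B\<^sup>2) * sqnorm g"
proof -
  have "sqnorm f \<le> (\<integral>\<^sup>+x. ennreal (B\<^sup>2) * ennreal ((cmod (g x))\<^sup>2) \<partial>lebesgue)"
    unfolding sqnorm_def
  proof (rule nn_integral_mono_AE)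
    show "AE x in lebesgue. ennreal ((cmod (f x))\<^sup>2) \<le> ennreal (B\<^sup>2) * ennreal ((cmod (g x))\<^sup>2)"
      using assms(1)
    proof eventually_elim
      case (elim x)
      then have "(cmod (f x))\<^sup>2 \<le> (B * cmod (g x))\<^sup>2"
        by (rule power_mono) simp
      then show ?case
        by (simp add: ennreal_mult[symmetric] power_mult_distrib)
    qed
  qed
  also have "\<dots> = ennreal (B\<^sup>2) * sqnorm g"
    unfolding sqnorm_def using g by (intro nn_integral_cmult) measurable
  finally show ?thesis .
qed

lemma sq_integrable_AE_bound:
  assumes "f \<in> borel_measurable lebesgue" "g \<in> sq_integrable"
    "AE x in lebesgue. cmod (f x) \<le> B * cmod (g x)" "B \<ge> 0"
  shows "f \<in> sq_integrable"
proof -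
  have "sqnorm f \<le> ennreal (B\<^sup>2) * sqnorm g"
    using assms by (intro sqnorm_AE_mono) (auto simp: sq_integrable_def)
  also have "\<dots> < \<infinity>"
    using assms(2) by (auto simp: sq_integrable_def ennreal_mult_less_top)
  finally show ?thesis
    using assms(1) by (simp add: sq_integrable_def)
qed

text \<open>
  Letting \<open>e\<close> vary gives what the triangle inequality would: in a fixed-point estimate the factor
  \<open>1 + e\<close> or \<open>1 + 1 / e\<close> on the contracted term can be brought as close to \<open>1\<close> as needed.
\<close>

lemma sqnorm_add_le:
  assumes f: "f \<in> borel_measurable lebesgue" and g: "g \<in> borel_measurable lebesgue" and "e > 0"
  shows "sqnorm (\<lambda>x. f x + g x) \<le> ennreal (1 + 1 / e) * sqnorm f + ennreal (1 + e) * sqnorm g"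
proof -
  have "ennreal ((cmod (f x + g x))\<^sup>2)
      \<le> ennreal (1 + 1 / e) * ennreal ((cmod (f x))\<^sup>2) + ennreal (1 + e) * ennreal ((cmod (g x))\<^sup>2)" for x
  proof -
    define s t where "s = cmod (f x)" and "t = cmod (g x)"
    have "(cmod (f x + g x))\<^sup>2 \<le> (s + t)\<^sup>2"
      unfolding s_def t_def by (intro power_mono norm_triangle_ineq) simp
    also have "\<dots> \<le> (1 + 1 / e) * s\<^sup>2 + (1 + e) * t\<^sup>2"
    proof -
      have "2 * s * t \<le> 1 / e * s\<^sup>2 + e * t\<^sup>2"
      proof -
        have "0 \<le> (s - e * t)\<^sup>2 / e" using \<open>e > 0\<close> by simp
        also have "\<dots> = 1 / e * s\<^sup>2 + e * t\<^sup>2 - 2 * s * t"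
          using \<open>e > 0\<close> by (simp add: power2_eq_square field_simps)
        finally show ?thesis by simp
      qed
      then show ?thesis by (simp add: power2_sum algebra_simps)
    qed
    finally show ?thesis
      using \<open>e > 0\<close> unfolding s_def t_def
      by (simp add: ennreal_mult[symmetric] ennreal_plus[symmetric] del: ennreal_plus)
  qed
  then have "sqnorm (\<lambda>x. f x + g x)
      \<le> (\<integral>\<^sup>+x. ennreal (1 + 1 / e) * ennreal ((cmod (f x))\<^sup>2) + ennreal (1 + e) * ennreal ((cmod (g x))\<^sup>2) \<partial>lebesgue)"
    unfolding sqnorm_def by (intro nn_integral_mono)
  also have "\<dots> = ennreal (1 + 1 / e) * sqnorm f + ennreal (1 + e) * sqnorm g"
    unfolding sqnorm_def using f g by (simp add: nn_integral_add nn_integral_cmult)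
  finally show ?thesis .
qed

lemma sq_integrable_add:
  assumes "f \<in> sq_integrable" "g \<in> sq_integrable"
  shows "(\<lambda>x. f x + g x) \<in> sq_integrable"
proof -
  have "sqnorm (\<lambda>x. f x + g x) \<le> ennreal (1 + 1 / 1) * sqnorm f + ennreal (1 + 1) * sqnorm g"
    using assms by (intro sqnorm_add_le) (auto simp: sq_integrable_def)
  also have "\<dots> < \<infinity>"
    using assms by (auto simp: sq_integrable_def ennreal_mult_less_top)
  finally show ?thesis
    using assms by (auto simp: sq_integrable_def intro: borel_measurable_add)
qed

lemma sq_integrable_cmult:
  assumes "f \<in> sq_integrable"
  shows "(\<lambda>x. a * f x) \<in> sq_integrable"
  using assms by (intro sq_integrable_AE_bound[OF _ assms, of _ "cmod a"]) (auto simp: sq_integrable_def norm_mult)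

lemma sq_integrable_diff:
  assumes "f \<in> sq_integrable" "g \<in> sq_integrable"
  shows "(\<lambda>x. f x - g x) \<in> sq_integrable"
  using sq_integrable_add[OF assms(1) sq_integrable_cmult[OF assms(2), of "-1"]] by simp

section \<open>Green's operator of the scalar equation\<close>

text \<open>
  The fundamental solution of \<open>f' = c f + \<delta>\<close> that decays at both ends of the line; it is causal for
  \<open>Re c < 0\<close> and anticausal for \<open>Re c > 0\<close>.
\<close>

definition green :: "complex \<Rightarrow> real \<Rightarrow> complex" where
  "green c t = (if Re c < 0 then (if t \<ge> 0 then exp (c * of_real t) else 0)
                else (if t \<le> 0 then - exp (c * of_real t) else 0))"

definition green_op :: "complex \<Rightarrow> (real \<Rightarrow> complex) \<Rightarrow> real \<Rightarrow> complex" where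
  "green_op c u x = (LINT y|lebesgue. green c (x - y) * u y)"

lemma borel_measurable_green[measurable]: "green c \<in> borel_measurable borel"
proof -
  have [measurable]: "(\<lambda>t. exp (c * complex_of_real t)) \<in> borel_measurable borel"
    by (intro borel_measurable_continuous_onI continuous_intros)
  show ?thesis
    unfolding green_def[abs_def] by measurable
qed

lemma cmod_green_le_1: "cmod (green c t) \<le> 1"
  by (auto simp: green_def norm_exp_eq_Re mult_nonneg_nonpos mult_nonpos_nonneg)

lemma cmod_green_reflect:
  assumes "Re c \<noteq> 0"
  shows "cmod (green (- c) (- t)) = cmod (green c t)"
  using assms by (auto simp: green_def norm_exp_eq_Re)

lemma nn_integral_green_neg:
  assumes "Re c < 0"
  shows "(\<integral>\<^sup>+t. ennreal (cmod (green c t)) \<partial>lborel) = ennreal (1 / \<bar>Re c\<bar>)"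
proof -
  have "(\<integral>\<^sup>+t. ennreal (cmod (green c t)) \<partial>lborel)
      = (\<integral>\<^sup>+t. ennreal (exp (Re c * t)) * indicator {0..} t \<partial>lborel)"
    using assms by (intro nn_integral_cong) (auto simp: green_def indicator_def norm_exp_eq_Re)
  also have "\<dots> = ennreal (0 - exp (Re c * 0) / Re c)"
  proof (rule nn_integral_FTC_atLeast)
    show "((\<lambda>t. exp (Re c * t) / Re c) has_real_derivative exp (Re c * x)) (at x)" for x
      using assms by (auto intro!: derivative_eq_intros)
    show "((\<lambda>t. exp (Re c * t) / Re c) \<longlongrightarrow> 0) at_top"
      using assms by real_asymp
  qed auto
  finally show ?thesis using assms by simp
qed

text \<open>
  The value \<open>1 / |Re c|\<close> of the \<open>L\<^sup>1\<close> norm is where the bound on the spectrum comes from: with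
  \<open>c = - i z / h\<close> it equals \<open>h / |Im z|\<close>. The case \<open>Re c > 0\<close> is the mirror image of \<open>Re c < 0\<close>.
\<close>

lemma nn_integral_green:
  assumes "Re c \<noteq> 0"
  shows "(\<integral>\<^sup>+t. ennreal (cmod (green c t)) \<partial>lborel) = ennreal (1 / \<bar>Re c\<bar>)"
proof (cases "Re c < 0")
  case False
  then have "Re (- c) < 0" using assms by simp
  from nn_integral_green_neg[OF this]
  have "(\<integral>\<^sup>+t. ennreal (cmod (green (- c) t)) \<partial>lborel) = ennreal (1 / \<bar>Re c\<bar>)"
    by simp
  also have "(\<integral>\<^sup>+t. ennreal (cmod (green (- c) t)) \<partial>lborel) = (\<integral>\<^sup>+t. ennreal (cmod (green (- c) (- t))) \<partial>lborel)"
    by (subst nn_integral_real_affine[where c = "-1" and t = 0]) auto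
  finally show ?thesis
    using cmod_green_reflect[OF assms] by simp
qed (use nn_integral_green_neg in blast)

lemma nn_integral_green_translate:
  assumes "Re c \<noteq> 0"
  shows "(\<integral>\<^sup>+y. ennreal (cmod (green c (x - y))) \<partial>lborel) = ennreal (1 / \<bar>Re c\<bar>)"
    and "(\<integral>\<^sup>+x. ennreal (cmod (green c (x - y))) \<partial>lborel) = ennreal (1 / \<bar>Re c\<bar>)"
proof -
  show "(\<integral>\<^sup>+y. ennreal (cmod (green c (x - y))) \<partial>lborel) = ennreal (1 / \<bar>Re c\<bar>)"
    unfolding nn_integral_green[OF assms, symmetric]
    by (subst (2) nn_integral_real_affine[where c = "-1" and t = x]) auto
  show "(\<integral>\<^sup>+x. ennreal (cmod (green c (x - y))) \<partial>lborel) = ennreal (1 / \<bar>Re c\<bar>)"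
    unfolding nn_integral_green[OF assms, symmetric]
    by (subst (2) nn_integral_real_affine[where c = 1 and t = "- y"]) auto
qed

lemma borel_measurable_green_translate:
  "(\<lambda>y. green c (x - y)) \<in> borel_measurable lebesgue"
  by (intro measurable_completion) measurable

lemma integrable_green_translate:
  assumes "Re c \<noteq> 0"
  shows "integrable lebesgue (\<lambda>y. cmod (green c (x - y)))"
    and "(LINT y|lebesgue. cmod (green c (x - y))) = 1 / \<bar>Re c\<bar>"
proof -
  have nn: "(\<integral>\<^sup>+y. ennreal (cmod (green c (x - y))) \<partial>lebesgue) = ennreal (1 / \<bar>Re c\<bar>)"
    using nn_integral_green_translate(1)[OF assms] by (simp add: nn_integral_completion)
  show "integrable lebesgue (\<lambda>y. cmod (green c (x - y)))"
    using nn borel_measurable_green_translate by (intro integrableI_bounded) auto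
  show "(LINT y|lebesgue. cmod (green c (x - y))) = 1 / \<bar>Re c\<bar>"
    by (subst integral_eq_nn_integral) (use nn borel_measurable_green_translate in auto)
qed

lemma integrable_green_mult:
  assumes "Re c \<noteq> 0" "u \<in> sq_integrable"
  shows "integrable lebesgue (\<lambda>y. green c (x - y) * u y)"
    and "(LINT y|lebesgue. cmod (green c (x - y) * u y)) \<le> 1 / \<bar>Re c\<bar> + (LINT y|lebesgue. (cmod (u y))\<^sup>2)"
proof -
  note u = sq_integrableD[OF assms(2)]
  have i: "integrable lebesgue (\<lambda>y. cmod (green c (x - y)) + (cmod (u y))\<^sup>2)"
    using integrable_green_translate(1)[OF assms(1)] u(2) by (rule Bochner_Integration.integrable_add)
  have le: "cmod (green c (x - y) * u y) \<le> cmod (green c (x - y)) + (cmod (u y))\<^sup>2" for y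
  proof -
    have "cmod (green c (x - y) * u y) \<le> cmod (green c (x - y)) * (1 / (4 * 1) + 1 * (cmod (u y))\<^sup>2)"
      unfolding norm_mult by (intro mult_left_mono le_inverse_plus_square) auto
    also have "\<dots> = cmod (green c (x - y)) / 4 + cmod (green c (x - y)) * (cmod (u y))\<^sup>2"
      by (simp add: algebra_simps)
    also have "\<dots> \<le> cmod (green c (x - y)) + 1 * (cmod (u y))\<^sup>2"
      using cmod_green_le_1 by (intro add_mono mult_right_mono) auto
    finally show ?thesis by simp
  qed
  show gi: "integrable lebesgue (\<lambda>y. green c (x - y) * u y)"
  proof (rule Bochner_Integration.integrable_bound[OF i])
    show "(\<lambda>y. green c (x - y) * u y) \<in> borel_measurable lebesgue"
      by (intro borel_measurable_times u(1) borel_measurable_green_translate)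
    show "AE y in lebesgue. cmod (green c (x - y) * u y) \<le> norm (cmod (green c (x - y)) + (cmod (u y))\<^sup>2)"
      using le by (intro AE_I2) (simp add: order_trans[OF le])
  qed
  have "(LINT y|lebesgue. cmod (green c (x - y) * u y)) \<le> (LINT y|lebesgue. cmod (green c (x - y)) + (cmod (u y))\<^sup>2)"
    by (intro integral_mono gi integrable_norm i le)
  also have "\<dots> = 1 / \<bar>Re c\<bar> + (LINT y|lebesgue. (cmod (u y))\<^sup>2)"
    using integrable_green_translate[OF assms(1)] u(2) by simp
  finally show "(LINT y|lebesgue. cmod (green c (x - y) * u y)) \<le> 1 / \<bar>Re c\<bar> + (LINT y|lebesgue. (cmod (u y))\<^sup>2)" .
qed

lemma green_op_diff:
  assumes "Re c \<noteq> 0" "u \<in> sq_integrable" "v \<in> sq_integrable"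
  shows "green_op c (\<lambda>y. u y - v y) x = green_op c u x - green_op c v x"
  unfolding green_op_def
  using integrable_green_mult(1)[OF assms(1,2)] integrable_green_mult(1)[OF assms(1,3)]
  by (simp add: right_diff_distrib)

lemma green_op_bounded:
  assumes "Re c \<noteq> 0" "u \<in> sq_integrable"
  shows "cmod (green_op c u x) \<le> 1 / \<bar>Re c\<bar> + (LINT y|lebesgue. (cmod (u y))\<^sup>2)"
  unfolding green_op_def
  by (rule order_trans[OF integral_norm_bound integrable_green_mult(2)[OF assms]])

lemma green_op_AE_bound:
  assumes "Re c \<noteq> 0" "u \<in> sq_integrable" "AE y in lebesgue. cmod (u y) \<le> M"
  shows "cmod (green_op c u x) \<le> M / \<bar>Re c\<bar>"
proof -
  have "cmod (green_op c u x) \<le> (LINT y|lebesgue. cmod (green c (x - y) * u y))"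
    unfolding green_op_def by (rule integral_norm_bound)
  also have "\<dots> \<le> (LINT y|lebesgue. cmod (green c (x - y)) * M)"
  proof (rule integral_mono_AE)
    show "AE y in lebesgue. cmod (green c (x - y) * u y) \<le> cmod (green c (x - y)) * M"
      using assms(3) by eventually_elim (simp add: norm_mult mult_left_mono)
  qed (use integrable_green_mult(1)[OF assms(1,2)] integrable_green_translate(1)[OF assms(1)] in auto)
  also have "\<dots> = M / \<bar>Re c\<bar>"
    using integrable_green_translate(2)[OF assms(1)] by simp
  finally show ?thesis .
qed

text \<open>
  Young's inequality \<open>\<parallel>k * u\<parallel>\<^sub>2 \<le> \<parallel>k\<parallel>\<^sub>1 \<parallel>u\<parallel>\<^sub>2\<close>. One factor \<open>sqrt |k|\<close> of \<open>|k u|\<close> is split off for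
  Cauchy-Schwarz, which bounds \<open>|k * u|\<^sup>2\<close> by \<open>\<parallel>k\<parallel>\<^sub>1 (|k| * |u|\<^sup>2)\<close>, and Tonelli integrates the second
  factor. As a product of completed measures is not the completion of the product, Tonelli is
  applied with Borel measure and a Borel representative \<open>w\<close>
  of \<open>|u|\<^sup>2\<close>.
\<close>

lemma Young_green_op:
  assumes c: "Re c \<noteq> 0" and u: "u \<in> sq_integrable"
  shows "sqnorm (green_op c u) \<le> ennreal ((1 / \<bar>Re c\<bar>)\<^sup>2) * sqnorm u"
proof -
  note um = sq_integrableD(1)[OF u]
  define \<kappa> where "\<kappa> = ennreal (1 / \<bar>Re c\<bar>)"
  define k where "k x y = ennreal (cmod (green c (x - y)))" for x y
  have km: "k x \<in> borel_measurable lebesgue" for x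
    unfolding k_def by (intro measurable_compose[OF borel_measurable_green_translate]) measurable
  have "(\<lambda>y. ennreal ((cmod (u y))\<^sup>2)) \<in> borel_measurable lebesgue"
    using um by measurable
  from completion_ex_borel_measurable[OF this]
  obtain w where w: "w \<in> borel_measurable lborel" "AE y in lborel. ennreal ((cmod (u y))\<^sup>2) = w y"
    by blast
  have gm[measurable]: "(\<lambda>y. green c (x - y)) \<in> borel_measurable lebesgue" for x
    by (rule borel_measurable_green_translate)
  note um[measurable]
  have pointwise: "ennreal ((cmod (green_op c u x))\<^sup>2) \<le> \<kappa> * (\<integral>\<^sup>+y. k x y * w y \<partial>lborel)" for x
  proof -
    have "ennreal (cmod (green_op c u x)) \<le> (\<integral>\<^sup>+y. ennreal (cmod (green c (x - y) * u y)) \<partial>lebesgue)"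
      unfolding green_op_def by (rule integral_norm_bound_ennreal[OF integrable_green_mult(1)[OF c u]])
    also have "\<dots> = (\<integral>\<^sup>+y. ennreal (sqrt (cmod (green c (x - y)))) *
        ennreal (sqrt (cmod (green c (x - y))) * cmod (u y)) \<partial>lebesgue)"
      by (intro nn_integral_cong) (simp add: ennreal_mult[symmetric] norm_mult mult.assoc[symmetric])
    finally have "(ennreal (cmod (green_op c u x)))\<^sup>2 \<le> (\<integral>\<^sup>+y. ennreal (sqrt (cmod (green c (x - y)))) *
        ennreal (sqrt (cmod (green c (x - y))) * cmod (u y)) \<partial>lebesgue)\<^sup>2"
      by (rule power_mono) simp
    also have "\<dots> \<le> (\<integral>\<^sup>+y. (ennreal (sqrt (cmod (green c (x - y)))))\<^sup>2 \<partial>lebesgue) *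
        (\<integral>\<^sup>+y. (ennreal (sqrt (cmod (green c (x - y))) * cmod (u y)))\<^sup>2 \<partial>lebesgue)"
      by (intro Cauchy_Schwarz_nn_integral) measurable
    also have "(\<integral>\<^sup>+y. (ennreal (sqrt (cmod (green c (x - y)))))\<^sup>2 \<partial>lebesgue) = \<kappa>"
      unfolding \<kappa>_def nn_integral_green_translate(1)[OF c, of x, symmetric] nn_integral_completion
      by (intro nn_integral_cong) (simp add: ennreal_power)
    also have "(\<integral>\<^sup>+y. (ennreal (sqrt (cmod (green c (x - y))) * cmod (u y)))\<^sup>2 \<partial>lebesgue)
        = (\<integral>\<^sup>+y. k x y * ennreal ((cmod (u y))\<^sup>2) \<partial>lborel)"
      unfolding nn_integral_completion k_def
      by (intro nn_integral_cong) (simp add: ennreal_power power_mult_distrib ennreal_mult)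
    also have "\<dots> = (\<integral>\<^sup>+y. k x y * w y \<partial>lborel)"
      by (intro nn_integral_cong_AE eventually_mono[OF w(2)]) simp
    finally show ?thesis by (simp add: ennreal_power)
  qed
  have [measurable]: "w \<in> borel_measurable borel" using w(1) by simp
  have kpm: "(\<lambda>(x, y). k x y) \<in> borel_measurable (borel \<Otimes>\<^sub>M borel)"
    unfolding k_def by measurable
  have "sqnorm (green_op c u) \<le> (\<integral>\<^sup>+x. \<kappa> * (\<integral>\<^sup>+y. k x y * w y \<partial>lborel) \<partial>lborel)"
    unfolding sqnorm_def nn_integral_completion by (intro nn_integral_mono pointwise)
  also have "\<dots> = \<kappa> * (\<integral>\<^sup>+x. (\<integral>\<^sup>+y. k x y * w y \<partial>lborel) \<partial>lborel)"
    unfolding k_def by (intro nn_integral_cmult) measurable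
  also have "(\<integral>\<^sup>+x. (\<integral>\<^sup>+y. k x y * w y \<partial>lborel) \<partial>lborel) = (\<integral>\<^sup>+y. (\<integral>\<^sup>+x. k x y * w y \<partial>lborel) \<partial>lborel)"
    unfolding k_def by (rule lborel_pair.Fubini'[symmetric]) measurable
  also have "\<dots> = (\<integral>\<^sup>+y. \<kappa> * w y \<partial>lborel)"
  proof (rule nn_integral_cong)
    fix y
    have "(\<integral>\<^sup>+x. k x y * w y \<partial>lborel) = (\<integral>\<^sup>+x. k x y \<partial>lborel) * w y"
      unfolding k_def by (intro nn_integral_multc) measurable
    then show "(\<integral>\<^sup>+x. k x y * w y \<partial>lborel) = \<kappa> * w y"
      unfolding k_def \<kappa>_def nn_integral_green_translate(2)[OF c] .
  qed
  also have "\<dots> = \<kappa> * (\<integral>\<^sup>+y. w y \<partial>lborel)"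
    by (intro nn_integral_cmult) measurable
  also have "(\<integral>\<^sup>+y. w y \<partial>lborel) = sqnorm u"
    unfolding sqnorm_def nn_integral_completion
    by (intro nn_integral_cong_AE eventually_mono[OF w(2)]) simp
  also have "\<kappa> * (\<kappa> * sqnorm u) = ennreal ((1 / \<bar>Re c\<bar>)\<^sup>2) * sqnorm u"
    unfolding \<kappa>_def power2_eq_square mult.assoc[symmetric] by (subst ennreal_mult) auto
  finally show ?thesis .
qed

lemma abs_cont_on_interval_cong:
  assumes "abs_cont_on_interval a b f" "\<And>x. x \<in> {a..b} \<Longrightarrow> g x = f x"
  shows "abs_cont_on_interval a b g"
proof -
  have "(\<Sum>K\<in>d. cmod (g (Sup K) - g (Inf K))) = (\<Sum>K\<in>d. cmod (f (Sup K) - f (Inf K)))"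
    if d: "d division_of \<Union>d" "\<Union>d \<subseteq> {a..b}" for d
  proof (rule sum.cong[OF refl])
    fix K assume "K \<in> d"
    from division_member_Inf_Sup(3,4)[OF d(1) this d(2)]
    show "cmod (g (Sup K) - g (Inf K)) = cmod (f (Sup K) - f (Inf K))"
      by (simp only: assms(2))
  qed
  then show ?thesis
    using assms(1) unfolding abs_cont_on_interval_def by (simp cong: conj_cong imp_cong)
qed

lemma exp_cancel:
  "exp (- c * complex_of_real x) * exp (c * complex_of_real x) = 1"
  "exp (c * complex_of_real x) * exp (- c * complex_of_real x) = 1"
  by (simp_all add: mult_exp_exp)

lemma exp_mult_sq_integrable:
  assumes "u \<in> sq_integrable"
  shows "(\<lambda>y. exp (- c * complex_of_real y) * u y) \<in> borel_measurable lebesgue"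
    and "set_integrable lebesgue {a..b} (\<lambda>y. (cmod (exp (- c * complex_of_real y) * u y))\<^sup>2)"
    and "set_integrable lebesgue {a..b} (\<lambda>y. exp (- c * complex_of_real y) * u y)"
proof -
  note u = sq_integrableD[OF assms]
  have "(\<lambda>y. exp (- c * complex_of_real y)) \<in> borel_measurable borel"
    by (intro borel_measurable_continuous_onI continuous_intros)
  then have e: "(\<lambda>y. exp (- c * complex_of_real y)) \<in> borel_measurable lebesgue"
    by (intro measurable_completion) simp
  show m: "(\<lambda>y. exp (- c * complex_of_real y) * u y) \<in> borel_measurable lebesgue"
    by (intro borel_measurable_times e u(1))
  note [measurable] = m
  define M where "M = exp (cmod c * max \<bar>a\<bar> \<bar>b\<bar>)"
  have M: "cmod (exp (- c * complex_of_real y)) \<le> M" if "y \<in> {a..b}" for y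
  proof -
    have "cmod (exp (- c * complex_of_real y)) \<le> exp (cmod (- c * complex_of_real y))"
      by (rule norm_exp)
    also have "\<dots> \<le> M"
      unfolding M_def using that by (auto simp: norm_mult intro!: mult_left_mono)
    finally show ?thesis .
  qed
  show sq: "set_integrable lebesgue {a..b} (\<lambda>y. (cmod (exp (- c * complex_of_real y) * u y))\<^sup>2)"
    unfolding set_integrable_def
  proof (rule Bochner_Integration.integrable_bound)
    show "integrable lebesgue (\<lambda>y. M\<^sup>2 * (cmod (u y))\<^sup>2)"
      using u(2) by simp
    show "(\<lambda>y. indicat_real {a..b} y *\<^sub>R (cmod (exp (- c * complex_of_real y) * u y))\<^sup>2) \<in> borel_measurable lebesgue"
      by (intro borel_measurable_scaleR borel_measurable_indicator) (simp, measurable)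
    have "(cmod (exp (- c * complex_of_real y) * u y))\<^sup>2 \<le> M\<^sup>2 * (cmod (u y))\<^sup>2" if "y \<in> {a..b}" for y
      unfolding norm_mult power_mult_distrib
      using M[OF that] by (intro mult_right_mono power_mono) auto
    then show "AE y in lebesgue. norm (indicat_real {a..b} y *\<^sub>R (cmod (exp (- c * complex_of_real y) * u y))\<^sup>2)
        \<le> norm (M\<^sup>2 * (cmod (u y))\<^sup>2)"
      by (intro AE_I2) (simp add: indicator_def)
  qed
  show "set_integrable lebesgue {a..b} (\<lambda>y. exp (- c * complex_of_real y) * u y)"
    by (rule set_integrable_of_square[OF m sq])
qed

text \<open>
  The kernels for the observation points \<open>a\<close> and \<open>x\<close> have the same exponential tail, so after the
  factor \<open>exp (c (x - a))\<close> is removed they differ only for sources in \<open>{a..x}\<close>. This local formula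
  makes the nonlocal operator an indefinite integral times an exponential, and regularity can be
  read off from it.
\<close>

lemma Duhamel_green_op:
  assumes c: "Re c \<noteq> 0" and u: "u \<in> sq_integrable" and "a \<le> x"
  shows "green_op c u x = exp (c * complex_of_real x) *
    (exp (- c * complex_of_real a) * green_op c u a + integral {a..x} (\<lambda>y. exp (- c * complex_of_real y) * u y))"
proof -
  let ?v = "\<lambda>y. exp (- c * complex_of_real y) * u y"
  have shift: "exp (- c * complex_of_real t) * exp (c * complex_of_real (t - y)) = exp (- c * complex_of_real y)" for t y
    by (simp add: mult_exp_exp algebra_simps)
  have split: "indicat_real {a..x} y *\<^sub>R ?v y
      = exp (- c * complex_of_real x) * (green c (x - y) * u y) - exp (- c * complex_of_real a) * (green c (a - y) * u y)"
    if "y \<noteq> a" "y \<noteq> x" for y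
  proof -
    have "complex_of_real (indicat_real {a..x} y) * exp (- c * complex_of_real y)
        = exp (- c * complex_of_real x) * green c (x - y) - exp (- c * complex_of_real a) * green c (a - y)"
      using that \<open>a \<le> x\<close> shift[of x y] shift[of a y] unfolding green_def indicator_def by auto
    from arg_cong[OF this, of "\<lambda>w. w * u y"] show ?thesis
      by (simp add: scaleR_conv_of_real algebra_simps)
  qed
  have "AE y in lebesgue. y \<noteq> a \<and> y \<noteq> x"
    by (intro AE_completion AE_conjI AE_lborel_singleton)
  then have ae: "AE y in lebesgue. indicat_real {a..x} y *\<^sub>R ?v y
      = exp (- c * complex_of_real x) * (green c (x - y) * u y) - exp (- c * complex_of_real a) * (green c (a - y) * u y)"
    by eventually_elim (rule split, auto)
  note gi = integrable_green_mult(1)[OF c u]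
  have "integral {a..x} ?v = (LINT y|lebesgue. indicat_real {a..x} y *\<^sub>R ?v y)"
    using set_lebesgue_integral_eq_integral(2)[OF exp_mult_sq_integrable(3)[OF u]]
    unfolding set_lebesgue_integral_def by metis
  also have "\<dots> = (LINT y|lebesgue. exp (- c * complex_of_real x) * (green c (x - y) * u y)
      - exp (- c * complex_of_real a) * (green c (a - y) * u y))"
  proof (rule integral_cong_AE[OF _ _ ae])
    show "(\<lambda>y. indicat_real {a..x} y *\<^sub>R ?v y) \<in> borel_measurable lebesgue"
      using exp_mult_sq_integrable(3)[OF u] unfolding set_integrable_def by (rule borel_measurable_integrable)
    show "(\<lambda>y. exp (- c * complex_of_real x) * (green c (x - y) * u y)
      - exp (- c * complex_of_real a) * (green c (a - y) * u y)) \<in> borel_measurable lebesgue"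
      by (intro borel_measurable_integrable Bochner_Integration.integrable_diff integrable_mult_right gi)
  qed
  also have "\<dots> = exp (- c * complex_of_real x) * green_op c u x - exp (- c * complex_of_real a) * green_op c u a"
    unfolding green_op_def using gi by (subst Bochner_Integration.integral_diff) auto
  finally have "exp (c * complex_of_real x) *
    (exp (- c * complex_of_real a) * green_op c u a + integral {a..x} ?v)
    = exp (c * complex_of_real x) * (exp (- c * complex_of_real x) * green_op c u x)"
    by simp
  then show ?thesis
    by (simp only: mult.assoc[symmetric] exp_cancel) simp
qed

lemma green_op_AC_loc:
  assumes c: "Re c \<noteq> 0" and u: "u \<in> sq_integrable"
  shows "green_op c u \<in> AC_loc"
proof -
  have "abs_cont_on_interval a b (green_op c u)" for a b
  proof -
    let ?v = "\<lambda>y. exp (- c * complex_of_real y) * u y"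
    let ?I = "\<lambda>x. exp (- c * complex_of_real a) * green_op c u a + integral {a..x} ?v"
    have "abs_cont_on_interval a b (\<lambda>x. integral {a..x} ?v)"
      by (rule abs_cont_indefinite_integral) (rule exp_mult_sq_integrable[OF u])+
    then have "abs_cont_on_interval a b ?I"
      unfolding abs_cont_on_interval_def add_diff_cancel_left .
    with abs_cont_on_interval_exp
    have "abs_cont_on_interval a b (\<lambda>x. exp (c * complex_of_real x) * ?I x)"
      by (rule abs_cont_on_interval_mult)
    then show ?thesis
      by (rule abs_cont_on_interval_cong) (use Duhamel_green_op[OF c u] in simp)
  qed
  then show ?thesis by (simp add: AC_loc_def)
qed

lemma AC_loc_borel_measurable:
  assumes "f \<in> AC_loc"
  shows "f \<in> borel_measurable lebesgue"
proof -
  have "isCont f x" for x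
  proof -
    have "continuous_on {x - 1..x + 1} f"
      using assms by (intro abs_cont_on_interval_imp_continuous_on) (simp add: AC_loc_def)
    then show ?thesis
      by (rule continuous_on_interior) simp
  qed
  then have "f \<in> borel_measurable borel"
    by (intro borel_measurable_continuous_onI continuous_at_imp_continuous_on) auto
  then show ?thesis
    by (intro measurable_completion) simp
qed

lemma green_op_sq_integrable:
  assumes "Re c \<noteq> 0" "u \<in> sq_integrable"
  shows "green_op c u \<in> sq_integrable"
proof -
  have "sqnorm (green_op c u) < \<infinity>"
    using Young_green_op[OF assms] assms(2)
    by (auto simp: sq_integrable_def ennreal_mult_less_top intro: le_less_trans)
  then show ?thesis
    using AC_loc_borel_measurable[OF green_op_AC_loc[OF assms]] by (simp add: sq_integrable_def)
qed

text \<open>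
  Near \<open>x\<close> the Duhamel formula with base point \<open>x - 1\<close> presents \<open>green_op c u\<close> as a product to which
  the product rule and Lebesgue's differentiation theorem apply.
\<close>

lemma green_op_ODE:
  assumes c: "Re c \<noteq> 0" and u: "u \<in> sq_integrable"
  shows "AE x in lebesgue. (green_op c u has_vector_derivative (c * green_op c u x + u x)) (at x)"
proof -
  let ?v = "\<lambda>y. exp (- c * complex_of_real y) * u y"
  have "?v integrable_on {a..b}" for a b
    by (rule set_lebesgue_integral_eq_integral(1)[OF exp_mult_sq_integrable(3)[OF u]])
  from AE_has_vector_derivative_indefinite_integral[OF this]
  show ?thesis
  proof eventually_elim
    case (elim x)
    define a where "a = x - 1"
    let ?I = "\<lambda>x. exp (- c * complex_of_real a) * green_op c u a + integral {a..x} ?v"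
    have "a < x" "a \<le> x" by (simp_all add: a_def)
    have "((\<lambda>t. integral {a..t} ?v) has_vector_derivative ?v x) (at x)"
      using elim \<open>a < x\<close> by blast
    from has_vector_derivative_add[OF has_vector_derivative_const this]
    have I: "(?I has_vector_derivative ?v x) (at x)"
      by (simp only: add_0_left)
    have e: "((\<lambda>x. exp (c * complex_of_real x)) has_vector_derivative c * exp (c * complex_of_real x)) (at x)"
      by (rule has_vector_derivative_real_field[of "\<lambda>z. exp (c * z)"])
        (auto intro!: derivative_eq_intros)
    have eq: "exp (c * complex_of_real t) * ?I t = green_op c u t" if "a \<le> t" for t
      by (rule Duhamel_green_op[OF c u that, symmetric])
    have "exp (c * complex_of_real x) * ?v x = u x"
      by (simp only: mult.assoc[symmetric] exp_cancel mult_1_left)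
    with has_vector_derivative_mult[OF e I]
    have "((\<lambda>x. exp (c * complex_of_real x) * ?I x) has_vector_derivative u x + c * green_op c u x) (at x)"
      by (simp only: mult.assoc eq[OF \<open>a \<le> x\<close>])
    then have "((\<lambda>x. exp (c * complex_of_real x) * ?I x) has_vector_derivative c * green_op c u x + u x) (at x)"
      by (simp only: add.commute)
    then show ?case
      by (rule has_vector_derivative_transform_within_open[where S = "{a<..}"])
        (use \<open>a < x\<close> eq in simp_all)
  qed
qed

text \<open>
  On the half-line \<open>H\<close> where \<open>Re c * x \<ge> 0\<close> the exponential has modulus at least \<open>1\<close>.
\<close>

lemma exponential_sq_integrable_imp_zero:
  assumes "Re c \<noteq> 0" and sq: "(\<lambda>x. exp (c * complex_of_real x) * w) \<in> sq_integrable"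
  shows "w = 0"
proof (rule ccontr)
  assume "w \<noteq> 0"
  define H where "H = (if Re c < 0 then {..(0::real)} else {0..})"
  have Hs: "H \<in> sets lborel"
    by (simp add: H_def)
  have le: "cmod w \<le> cmod (exp (c * complex_of_real x) * w)" if "x \<in> H" for x
  proof -
    have "0 \<le> Re c * x"
      using that unfolding H_def by (cases "Re c < 0") (simp_all add: mult_nonpos_nonpos)
    then have "1 * cmod w \<le> exp (Re c * x) * cmod w"
      by (intro mult_right_mono) auto
    then show ?thesis
      by (simp add: norm_mult norm_exp_eq_Re)
  qed
  have H_ge: "of_nat n \<le> emeasure lborel H" for n
  proof -
    have "of_nat n = emeasure lborel (if Re c < 0 then {- real n..0} else {0..real n})"
      by (simp add: ennreal_of_nat_eq_real_of_nat)
    also have "\<dots> \<le> emeasure lborel H"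
      using Hs by (intro emeasure_mono) (auto simp: H_def)
    finally show ?thesis .
  qed
  have H_top: "emeasure lborel H = top"
  proof (rule ccontr)
    assume "emeasure lborel H \<noteq> top"
    then obtain n where "emeasure lborel H < of_nat n"
      using ennreal_Ex_less_of_nat less_top by blast
    with H_ge[of n] show False
      by (simp add: not_less[symmetric])
  qed
  have pos: "ennreal ((cmod w)\<^sup>2) \<noteq> 0"
    using \<open>w \<noteq> 0\<close> by (simp add: ennreal_eq_0_iff)
  have "top = ennreal ((cmod w)\<^sup>2) * emeasure lborel H"
    unfolding H_top using pos by (simp add: ennreal_mult_top)
  also have "\<dots> = (\<integral>\<^sup>+x. ennreal ((cmod w)\<^sup>2) * indicator H x \<partial>lborel)"
    by (rule nn_integral_cmult_indicator[OF Hs, symmetric])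
  also have "\<dots> \<le> (\<integral>\<^sup>+x. ennreal ((cmod (exp (c * complex_of_real x) * w))\<^sup>2) \<partial>lborel)"
  proof (rule nn_integral_mono)
    fix x
    show "ennreal ((cmod w)\<^sup>2) * indicator H x \<le> ennreal ((cmod (exp (c * complex_of_real x) * w))\<^sup>2)"
      using le[of x] by (cases "x \<in> H") (simp_all add: ennreal_leI power_mono)
  qed
  also have "\<dots> = sqnorm (\<lambda>x. exp (c * complex_of_real x) * w)"
    unfolding sqnorm_def nn_integral_completion ..
  finally show False
    using sq unfolding sq_integrable_def by (simp add: top.extremum_unique)
qed

text \<open>
  By the fundamental theorem of calculus for \<open>exp (- c x) * f x\<close>, the function \<open>f\<close> obeys the same
  Duhamel formula as \<open>green_op c u\<close>. Their difference is then a multiple of \<open>exp (c x)\<close>, and only the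
  zero multiple is square-integrable.
\<close>

lemma sq_integrable_green_op_unique:
  assumes c: "Re c \<noteq> 0" and u: "u \<in> sq_integrable"
    and f: "f \<in> sq_integrable" "f \<in> AC_loc"
    and ode: "AE x in lebesgue. (f has_vector_derivative (c * f x + u x)) (at x)"
  shows "f = green_op c u"
proof -
  let ?v = "\<lambda>y. exp (- c * complex_of_real y) * u y"
  have fD: "f x = exp (c * complex_of_real x) * (exp (- c * complex_of_real a) * f a + integral {a..x} ?v)"
    if "a \<le> x" for a x
  proof -
    have "abs_cont_on_interval a x (\<lambda>x. exp (- c * complex_of_real x) * f x)"
      using f(2) by (intro abs_cont_on_interval_mult abs_cont_on_interval_exp) (simp add: AC_loc_def)
    moreover have "AE x in lebesgue. ((\<lambda>x. exp (- c * complex_of_real x) * f x) has_vector_derivative ?v x) (at x)"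
      using ode
    proof eventually_elim
      case (elim x)
      have e: "((\<lambda>x. exp (- c * complex_of_real x)) has_vector_derivative - c * exp (- c * complex_of_real x)) (at x)"
        by (rule has_vector_derivative_real_field[of "\<lambda>z. exp (- c * z)"])
          (auto intro!: derivative_eq_intros)
      from has_vector_derivative_mult[OF e elim] show ?case
        by (simp add: algebra_simps)
    qed
    ultimately have "(?v has_integral exp (- c * complex_of_real x) * f x - exp (- c * complex_of_real a) * f a) {a..x}"
      by (rule fundamental_theorem_of_calculus_abs_cont[OF that])
    then have "integral {a..x} ?v = exp (- c * complex_of_real x) * f x - exp (- c * complex_of_real a) * f a"
      by (rule integral_unique)
    then have "exp (- c * complex_of_real a) * f a + integral {a..x} ?v = exp (- c * complex_of_real x) * f x"
      by simp
    then show ?thesis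
      by (simp only: mult.assoc[symmetric] exp_cancel mult_1_left)
  qed
  define d where "d x = f x - green_op c u x" for x
  have d_sq: "d \<in> sq_integrable"
    unfolding d_def using sq_integrable_diff[OF f(1) green_op_sq_integrable[OF c u]] .
  have d: "d x = exp (c * complex_of_real x) * (exp (- c * complex_of_real a) * d a)" if "a \<le> x" for a x
    unfolding d_def fD[OF that] Duhamel_green_op[OF c u that] by (simp add: algebra_simps)
  have d': "d x = exp (c * complex_of_real x) * d 0" for x
  proof (cases "x \<ge> 0")
    case False
    then have "d 0 = exp (- c * complex_of_real x) * d x"
      using d[of x 0] by simp
    then have "exp (c * complex_of_real x) * d 0
        = (exp (c * complex_of_real x) * exp (- c * complex_of_real x)) * d x"
      by (simp only: mult.assoc)
    then show ?thesis
      by (simp only: exp_cancel mult_1_left)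
  next
    case True
    from d[OF this] show ?thesis by simp
  qed
  have "d 0 = 0"
  proof (rule exponential_sq_integrable_imp_zero[OF c])
    show "(\<lambda>x. exp (c * complex_of_real x) * d 0) \<in> sq_integrable"
      using d_sq unfolding d'[symmetric] .
  qed
  then have "d x = 0" for x
    using d'[of x] by simp
  then show ?thesis
    by (auto simp: d_def)
qed

section \<open>Mean square estimates and a fixed point principle\<close>

definition l2sq :: "(real \<Rightarrow> complex) \<Rightarrow> real" where
  "l2sq f = (LINT x|lebesgue. (cmod (f x))\<^sup>2)"

lemma l2sq_nonneg: "0 \<le> l2sq f"
  by (simp add: l2sq_def)

lemma sqnorm_eq_l2sq: "f \<in> sq_integrable \<Longrightarrow> sqnorm f = ennreal (l2sq f)"
  unfolding l2sq_def by (rule sq_integrableD(3))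

lemma sq_integrable_bounded_mult:
  assumes "w \<in> borel_measurable lebesgue" "AE x in lebesgue. cmod (w x) \<le> A" "A \<ge> 0" "f \<in> sq_integrable"
  shows "(\<lambda>x. w x * f x) \<in> sq_integrable"
    and "l2sq (\<lambda>x. w x * f x) \<le> A\<^sup>2 * l2sq f"
proof -
  have ae: "AE x in lebesgue. cmod (w x * f x) \<le> A * cmod (f x)"
    using assms(2) by eventually_elim (simp add: norm_mult mult_right_mono)
  have fm: "f \<in> borel_measurable lebesgue"
    by (rule sq_integrableD(1)[OF assms(4)])
  show sq: "(\<lambda>x. w x * f x) \<in> sq_integrable"
    by (rule sq_integrable_AE_bound[OF borel_measurable_times[OF assms(1) fm] assms(4) ae assms(3)])
  have "ennreal (l2sq (\<lambda>x. w x * f x)) \<le> ennreal (A\<^sup>2 * l2sq f)"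
    using sqnorm_AE_mono[OF ae assms(3) fm] l2sq_nonneg[of f]
    by (simp add: sqnorm_eq_l2sq[OF sq] sqnorm_eq_l2sq[OF assms(4)] ennreal_mult)
  then show "l2sq (\<lambda>x. w x * f x) \<le> A\<^sup>2 * l2sq f"
    using l2sq_nonneg[of f] by (simp add: ennreal_le_iff)
qed

lemma l2sq_add_le:
  assumes f: "f \<in> sq_integrable" and g: "g \<in> sq_integrable" and "e > 0"
  shows "l2sq (\<lambda>x. f x + g x) \<le> (1 + 1 / e) * l2sq f + (1 + e) * l2sq g"
proof -
  have nn: "0 \<le> (1 + 1 / e) * l2sq f" "0 \<le> (1 + e) * l2sq g"
    "0 \<le> 1 + 1 / e" "0 \<le> 1 + e"
    using \<open>e > 0\<close> l2sq_nonneg by simp_all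
  have "ennreal (l2sq (\<lambda>x. f x + g x)) \<le> ennreal ((1 + 1 / e) * l2sq f + (1 + e) * l2sq g)"
    using sqnorm_add_le[OF sq_integrableD(1)[OF f] sq_integrableD(1)[OF g] \<open>e > 0\<close>] nn l2sq_nonneg
    unfolding sqnorm_eq_l2sq[OF f] sqnorm_eq_l2sq[OF g] sqnorm_eq_l2sq[OF sq_integrable_add[OF f g]]
    by (simp only: ennreal_mult[symmetric] ennreal_plus[symmetric])
  then show ?thesis
    by (simp only: ennreal_le_iff[OF add_nonneg_nonneg[OF nn(1,2)]])
qed

lemma l2sq_green_op_le:
  assumes "Re c \<noteq> 0" "u \<in> sq_integrable"
  shows "l2sq (green_op c u) \<le> (1 / \<bar>Re c\<bar>)\<^sup>2 * l2sq u"
proof -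
  have "ennreal (l2sq (green_op c u)) \<le> ennreal ((1 / \<bar>Re c\<bar>)\<^sup>2 * l2sq u)"
    using Young_green_op[OF assms]
    unfolding sqnorm_eq_l2sq[OF assms(2)] sqnorm_eq_l2sq[OF green_op_sq_integrable[OF assms]]
    by (subst ennreal_mult) (auto simp: l2sq_nonneg)
  then show ?thesis
    using l2sq_nonneg[of u] by (simp add: ennreal_le_iff)
qed

lemma l2sq_green_step:
  assumes c: "Re c \<noteq> 0"
    and w: "w \<in> borel_measurable lebesgue" "AE x in lebesgue. cmod (w x) \<le> A" "A \<ge> 0"
    and f: "f \<in> sq_integrable" and a: "a \<in> sq_integrable" and "e > 0"
  shows "l2sq (green_op c (\<lambda>x. w x * f x + a x))
    \<le> (1 + 1 / e) * (A / \<bar>Re c\<bar>)\<^sup>2 * l2sq f + (1 + e) * (1 / \<bar>Re c\<bar>)\<^sup>2 * l2sq a"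
proof -
  note wf = sq_integrable_bounded_mult[OF w f]
  have "l2sq (green_op c (\<lambda>x. w x * f x + a x)) \<le> (1 / \<bar>Re c\<bar>)\<^sup>2 * l2sq (\<lambda>x. w x * f x + a x)"
    by (intro l2sq_green_op_le c sq_integrable_add wf a)
  also have "\<dots> \<le> (1 / \<bar>Re c\<bar>)\<^sup>2 * ((1 + 1 / e) * l2sq (\<lambda>x. w x * f x) + (1 + e) * l2sq a)"
    by (intro mult_left_mono l2sq_add_le wf a \<open>e > 0\<close>) simp
  also have "\<dots> \<le> (1 / \<bar>Re c\<bar>)\<^sup>2 * ((1 + 1 / e) * (A\<^sup>2 * l2sq f) + (1 + e) * l2sq a)"
    using \<open>e > 0\<close> by (intro mult_left_mono add_right_mono wf) auto
  also have "\<dots> = (1 + 1 / e) * (A / \<bar>Re c\<bar>)\<^sup>2 * l2sq f + (1 + e) * (1 / \<bar>Re c\<bar>)\<^sup>2 * l2sq a"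
    by (simp only: power_divide power_one) (simp add: distrib_left)
  finally show ?thesis .
qed

text \<open>
  The iterates converge uniformly because \<open>S\<close> contracts the supremum norm; the affine bound keeps their \<open>L\<^sup>2\<close> norms bounded, and Fatou's lemma passes
  this bound to the limit. The supremum norm works with actual functions rather than classes modulo
  null sets, and the fixed point equation holds at every point.
\<close>

lemma sq_integrable_fixed_point:
  fixes S :: "(real \<Rightarrow> complex) \<Rightarrow> real \<Rightarrow> complex"
  assumes S: "\<And>f. f \<in> sq_integrable \<Longrightarrow> S f \<in> sq_integrable"
    and r: "0 \<le> r" "r < 1"
    and contr: "\<And>f g M x. f \<in> sq_integrable \<Longrightarrow> g \<in> sq_integrable \<Longrightarrow> (\<And>x. cmod (f x - g x) \<le> M)
        \<Longrightarrow> cmod (S f x - S g x) \<le> r * M"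
    and s: "0 \<le> s" "s < 1"
    and bound: "\<And>f. f \<in> sq_integrable \<Longrightarrow> l2sq (S f) \<le> K + s * l2sq f"
    and S0: "\<And>x. cmod (S (\<lambda>_. 0) x) \<le> M0"
  shows "\<exists>f\<in>sq_integrable. S f = f"
proof -
  define F where "F n = (S ^^ n) (\<lambda>_. 0)" for n
  have F0: "F 0 = (\<lambda>_. 0)" and FS: "F (Suc n) = S (F n)" for n
    by (simp_all add: F_def)
  have zero: "(\<lambda>_. 0) \<in> sq_integrable"
    by (simp add: sq_integrable_def sqnorm_def)
  have F: "F n \<in> sq_integrable" for n
    by (induction n) (simp_all add: F0 FS zero S)
  have step: "cmod (F (Suc n) x - F n x) \<le> r ^ n * M0" for n x
  proof (induction n arbitrary: x)
    case 0
    show ?case using S0[of x] by (simp add: FS F0)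
  next
    case (Suc n)
    show ?case
      using contr[OF F[of "Suc n"] F[of n] Suc.IH, of x] unfolding FS by (simp add: mult.assoc)
  qed
  \<comment> \<open>The tail of the geometric series that majorizes the increments.\<close>
  define D where "D n = r ^ n * M0 / (1 - r)" for n
  have "M0 \<ge> 0" using order_trans[OF norm_ge_zero S0[of 0]] .
  then have D_nonneg: "D n \<ge> 0" for n
    using r by (simp add: D_def)
  have D_step: "D n - D (Suc n) = r ^ n * M0" for n
  proof -
    have "D n - D (Suc n) = (r ^ n * M0) * (1 - r) / (1 - r)"
      by (simp add: D_def diff_divide_distrib[symmetric] algebra_simps)
    then show ?thesis using r by simp
  qed
  have "(\<lambda>n. r ^ n) \<longlonglongrightarrow> 0"
    using r by (intro LIMSEQ_realpow_zero)
  then have D_lim: "D \<longlonglongrightarrow> 0"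
    unfolding D_def by (intro tendsto_divide_zero tendsto_mult_left_zero)
  have tele: "cmod (F (n + k) x - F n x) \<le> D n - D (n + k)" for n k x
  proof (induction k)
    case (Suc k)
    have "cmod (F (n + Suc k) x - F n x) \<le> cmod (F (Suc (n + k)) x - F (n + k) x) + cmod (F (n + k) x - F n x)"
      using norm_triangle_ineq[of "F (Suc (n + k)) x - F (n + k) x" "F (n + k) x - F n x"] by simp
    then show ?case
      using Suc.IH step[of "n + k" x] D_step[of "n + k"] by simp
  qed simp
  have tail: "cmod (F m x - F n x) \<le> D n" if "n \<le> m" for m n x
    using tele[of n "m - n" x] D_nonneg[of m] that by simp
  have conv: "convergent (\<lambda>n. F n x)" for x
  proof (rule Cauchy_convergent, rule metric_CauchyI)
    fix e :: real assume "e > 0"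
    then obtain N where N: "D N < e / 2"
      using order_tendstoD(2)[OF D_lim, of "e / 2"] by (auto simp: eventually_sequentially)
    have "dist (F m x) (F n x) < e" if "m \<ge> N" "n \<ge> N" for m n
    proof -
      have "dist (F m x) (F n x) \<le> dist (F m x) (F N x) + dist (F n x) (F N x)"
        by (rule dist_triangle2)
      also have "\<dots> \<le> D N + D N"
        unfolding dist_norm by (intro add_mono tail that)
      finally show ?thesis using N by simp
    qed
    then show "\<exists>N. \<forall>m\<ge>N. \<forall>n\<ge>N. dist (F m x) (F n x) < e" by blast
  qed
  define f where "f x = lim (\<lambda>n. F n x)" for x
  have lim: "(\<lambda>n. F n x) \<longlonglongrightarrow> f x" for x
    unfolding f_def using conv by (rule convergent_LIMSEQ_iff[THEN iffD1])
  have f_tail: "cmod (f x - F n x) \<le> D n" for n x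
  proof (rule LIMSEQ_le_const2)
    show "(\<lambda>m. cmod (F m x - F n x)) \<longlonglongrightarrow> cmod (f x - F n x)"
      by (intro tendsto_intros lim)
    show "\<exists>N. \<forall>m\<ge>N. cmod (F m x - F n x) \<le> D n"
      using tail by blast
  qed
  have f_sq: "f \<in> sq_integrable"
  proof -
    have Fm: "F n \<in> borel_measurable lebesgue" for n
      by (rule sq_integrableD(1)[OF F])
    have fm: "f \<in> borel_measurable lebesgue"
      using Fm lim by (rule borel_measurable_LIMSEQ_metric)
    define L where "L = \<bar>K\<bar> / (1 - s)"
    have FL: "l2sq (F n) \<le> L" for n
    proof (induction n)
      case 0
      show ?case using s by (simp add: F0 l2sq_def L_def)
    next
      case (Suc n)
      have "l2sq (F (Suc n)) \<le> K + s * l2sq (F n)"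
        unfolding FS by (rule bound[OF F])
      also have "\<dots> \<le> \<bar>K\<bar> + s * L"
        using Suc.IH s by (intro add_mono mult_left_mono) auto
      also have "\<dots> = L"
        using s by (simp add: L_def field_simps)
      finally show ?case .
    qed
    have "sqnorm f = (\<integral>\<^sup>+x. liminf (\<lambda>n. ennreal ((cmod (F n x))\<^sup>2)) \<partial>lebesgue)"
      unfolding sqnorm_def
    proof (rule nn_integral_cong)
      fix x
      have "(\<lambda>n. ennreal ((cmod (F n x))\<^sup>2)) \<longlonglongrightarrow> ennreal ((cmod (f x))\<^sup>2)"
        by (intro tendsto_ennrealI tendsto_intros lim)
      from lim_imp_Liminf[OF _ this]
      show "ennreal ((cmod (f x))\<^sup>2) = liminf (\<lambda>n. ennreal ((cmod (F n x))\<^sup>2))"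
        by simp
    qed
    also have "\<dots> \<le> liminf (\<lambda>n. sqnorm (F n))"
      unfolding sqnorm_def using Fm by (intro nn_integral_liminf) measurable
    also have "\<dots> \<le> ennreal L"
    proof -
      have "sqnorm (F n) \<le> ennreal L" for n
        using FL[of n] by (simp add: sqnorm_eq_l2sq[OF F] ennreal_leI)
      then have "liminf (\<lambda>n. sqnorm (F n)) \<le> liminf (\<lambda>n::nat. ennreal L)"
        by (intro Liminf_mono always_eventually allI)
      then show ?thesis by (simp add: Liminf_const)
    qed
    finally have "sqnorm f \<le> ennreal L" .
    then have "sqnorm f < \<infinity>"
      by (rule le_less_trans) simp
    with fm show ?thesis
      by (simp add: sq_integrable_def)
  qed
  have "S f x = f x" for x
  proof (rule LIMSEQ_unique)
    show "(\<lambda>n. F (Suc n) x) \<longlonglongrightarrow> f x"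
      using lim by (rule LIMSEQ_Suc)
    have "(\<lambda>n. F (Suc n) x - S f x) \<longlonglongrightarrow> 0"
    proof (rule Lim_null_comparison)
      show "\<forall>\<^sub>F n in sequentially. norm (F (Suc n) x - S f x) \<le> r * D n"
        using contr[OF f_sq F f_tail, of x] unfolding FS
        by (intro always_eventually allI) (simp add: norm_minus_commute)
      show "(\<lambda>n. r * D n) \<longlonglongrightarrow> 0"
        by (intro tendsto_mult_right_zero D_lim)
    qed
    then show "(\<lambda>n. F (Suc n) x) \<longlonglongrightarrow> S f x"
      by (rule LIM_zero_cancel)
  qed
  then show ?thesis
    using f_sq by (intro bexI[of _ f]) auto
qed

section \<open>The first-order system\<close>

text \<open>
  The resolvent equation, solved for the derivatives, is
  \<open>f' = c f + \<alpha> g + a\<close>, \<open>g' = - c g + \<beta> f + b\<close>. Each equation alone is inverted by Green's operator,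
  which has norm at most \<open>1 / |Re c|\<close> both on \<open>L\<^sup>2\<close> and in the supremum norm; eliminating \<open>g\<close> gives
  \<open>f = solve1 a (solve2 b f)\<close>, a map with contraction rate \<open>A B / (Re c)\<^sup>2\<close>. Only the product of the
  bounds on the two coefficients enters, since the two coefficients are met once each per round.
\<close>

locale dirac_system =
  fixes c :: complex and \<alpha> \<beta> :: "real \<Rightarrow> complex" and A B :: real
  assumes Re_c: "Re c \<noteq> 0"
    and \<alpha>_meas: "\<alpha> \<in> borel_measurable lebesgue" and \<alpha>_bound: "AE x in lebesgue. cmod (\<alpha> x) \<le> A"
    and \<beta>_meas: "\<beta> \<in> borel_measurable lebesgue" and \<beta>_bound: "AE x in lebesgue. cmod (\<beta> x) \<le> B"
    and A_nonneg: "A \<ge> 0" and B_nonneg: "B \<ge> 0"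
    and small: "A * B < (Re c)\<^sup>2"
begin

definition rate :: real where "rate = (A / \<bar>Re c\<bar>) * (B / \<bar>Re c\<bar>)"

lemma rate: "0 \<le> rate" "rate < 1"
  using A_nonneg B_nonneg small Re_c by (auto simp: rate_def power2_eq_square divide_simps)

lemma Re_minus_c: "Re (- c) \<noteq> 0"
  using Re_c by simp

text \<open>
  The inequality \<open>|u + v|\<^sup>2 \<le> (1 + 1 / e) |u|\<^sup>2 + (1 + e) |v|\<^sup>2\<close> costs a factor \<open>1 + 1 / e\<close> in each of
  the two equations. As the bounds are on squared norms, one round costs \<open>((1 + 1 / e) * rate)\<^sup>2\<close>,
  which a large \<open>e\<close> keeps below \<open>1\<close>.
\<close>

lemma ex_absorbing_weight:
  obtains e where "e > 0" "(1 + 1 / e) * rate < 1"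
proof (cases "rate = 0")
  case True
  then show ?thesis using that[of 1] by simp
next
  case False
  then have "0 < rate" using rate by simp
  define e where "e = 2 * rate / (1 - rate)"
  have "e > 0" using \<open>0 < rate\<close> rate by (simp add: e_def)
  have "1 / e * rate = (1 - rate) / 2"
    using \<open>0 < rate\<close> rate by (simp add: e_def)
  then have "(1 + 1 / e) * rate = rate + (1 - rate) / 2"
    by (simp add: distrib_right)
  also have "\<dots> < 1" using rate by (simp add: field_simps)
  finally show ?thesis using that \<open>e > 0\<close> by blast
qed

definition solve2 :: "(real \<Rightarrow> complex) \<Rightarrow> (real \<Rightarrow> complex) \<Rightarrow> real \<Rightarrow> complex" where
  "solve2 b f = green_op (- c) (\<lambda>x. \<beta> x * f x + b x)"

definition solve1 :: "(real \<Rightarrow> complex) \<Rightarrow> (real \<Rightarrow> complex) \<Rightarrow> real \<Rightarrow> complex" where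
  "solve1 a f = green_op c (\<lambda>x. \<alpha> x * f x + a x)"

lemma rhs_sq_integrable:
  assumes "f \<in> sq_integrable" "b \<in> sq_integrable"
  shows "(\<lambda>x. \<beta> x * f x + b x) \<in> sq_integrable" "(\<lambda>x. \<alpha> x * f x + b x) \<in> sq_integrable"
  using assms
  by (auto intro!: sq_integrable_add sq_integrable_bounded_mult(1)[OF \<beta>_meas \<beta>_bound B_nonneg]
      sq_integrable_bounded_mult(1)[OF \<alpha>_meas \<alpha>_bound A_nonneg])

lemma solve_sq_integrable:
  assumes "f \<in> sq_integrable" "b \<in> sq_integrable"
  shows "solve2 b f \<in> sq_integrable" "solve1 b f \<in> sq_integrable"
  unfolding solve1_def solve2_def
  by (intro green_op_sq_integrable Re_c Re_minus_c rhs_sq_integrable assms)+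

lemma solve1_diff_le:
  assumes "f \<in> sq_integrable" "g \<in> sq_integrable" "a \<in> sq_integrable" "\<And>x. cmod (f x - g x) \<le> M"
  shows "cmod (solve1 a f x - solve1 a g x) \<le> A * M / \<bar>Re c\<bar>"
proof -
  have "solve1 a f x - solve1 a g x = green_op c (\<lambda>x. (\<alpha> x * f x + a x) - (\<alpha> x * g x + a x)) x"
    unfolding solve1_def by (intro green_op_diff[symmetric] Re_c rhs_sq_integrable assms)
  also have "cmod \<dots> \<le> A * M / \<bar>Re c\<bar>"
  proof (rule green_op_AE_bound[OF Re_c])
    show "(\<lambda>x. (\<alpha> x * f x + a x) - (\<alpha> x * g x + a x)) \<in> sq_integrable"
      by (intro sq_integrable_diff rhs_sq_integrable assms)
    show "AE x in lebesgue. cmod ((\<alpha> x * f x + a x) - (\<alpha> x * g x + a x)) \<le> A * M"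
      using \<alpha>_bound
    proof eventually_elim
      case (elim x)
      have "(\<alpha> x * f x + a x) - (\<alpha> x * g x + a x) = \<alpha> x * (f x - g x)"
        by (simp add: algebra_simps)
      then show ?case
        using elim assms(4)[of x] A_nonneg by (simp only: norm_mult) (intro mult_mono, auto)
    qed
  qed
  finally show ?thesis .
qed

lemma solve2_diff_le:
  assumes "f \<in> sq_integrable" "g \<in> sq_integrable" "b \<in> sq_integrable" "\<And>x. cmod (f x - g x) \<le> M"
  shows "cmod (solve2 b f x - solve2 b g x) \<le> B * M / \<bar>Re c\<bar>"
proof -
  have "solve2 b f x - solve2 b g x = green_op (- c) (\<lambda>x. (\<beta> x * f x + b x) - (\<beta> x * g x + b x)) x"
    unfolding solve2_def by (intro green_op_diff[symmetric] Re_minus_c rhs_sq_integrable assms)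
  also have "cmod \<dots> \<le> B * M / \<bar>Re (- c)\<bar>"
  proof (rule green_op_AE_bound[OF Re_minus_c])
    show "(\<lambda>x. (\<beta> x * f x + b x) - (\<beta> x * g x + b x)) \<in> sq_integrable"
      by (intro sq_integrable_diff rhs_sq_integrable assms)
    show "AE x in lebesgue. cmod ((\<beta> x * f x + b x) - (\<beta> x * g x + b x)) \<le> B * M"
      using \<beta>_bound
    proof eventually_elim
      case (elim x)
      have "(\<beta> x * f x + b x) - (\<beta> x * g x + b x) = \<beta> x * (f x - g x)"
        by (simp add: algebra_simps)
      then show ?case
        using elim assms(4)[of x] B_nonneg by (simp only: norm_mult) (intro mult_mono, auto)
    qed
  qed
  finally show ?thesis by simp
qed

lemma solve_l2sq:
  assumes "f \<in> sq_integrable" "b \<in> sq_integrable" "e > 0"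
  shows "l2sq (solve2 b f) \<le> (1 + 1 / e) * (B / \<bar>Re c\<bar>)\<^sup>2 * l2sq f + (1 + e) * (1 / \<bar>Re c\<bar>)\<^sup>2 * l2sq b"
    and "l2sq (solve1 b f) \<le> (1 + 1 / e) * (A / \<bar>Re c\<bar>)\<^sup>2 * l2sq f + (1 + e) * (1 / \<bar>Re c\<bar>)\<^sup>2 * l2sq b"
proof -
  have "l2sq (solve2 b f) \<le> (1 + 1 / e) * (B / \<bar>Re (- c)\<bar>)\<^sup>2 * l2sq f + (1 + e) * (1 / \<bar>Re (- c)\<bar>)\<^sup>2 * l2sq b"
    unfolding solve2_def by (intro l2sq_green_step Re_minus_c \<beta>_meas \<beta>_bound B_nonneg assms)
  then show "l2sq (solve2 b f) \<le> (1 + 1 / e) * (B / \<bar>Re c\<bar>)\<^sup>2 * l2sq f + (1 + e) * (1 / \<bar>Re c\<bar>)\<^sup>2 * l2sq b"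
    by simp
  show "l2sq (solve1 b f) \<le> (1 + 1 / e) * (A / \<bar>Re c\<bar>)\<^sup>2 * l2sq f + (1 + e) * (1 / \<bar>Re c\<bar>)\<^sup>2 * l2sq b"
    unfolding solve1_def by (intro l2sq_green_step Re_c \<alpha>_meas \<alpha>_bound A_nonneg assms)
qed

lemma ex_l2sq_bounds:
  obtains s1 s2 t where "s1 \<ge> 0" "s2 \<ge> 0" "t \<ge> 0" "s1 * s2 < 1"
    "\<And>f a. f \<in> sq_integrable \<Longrightarrow> a \<in> sq_integrable \<Longrightarrow> l2sq (solve1 a f) \<le> s1 * l2sq f + t * l2sq a"
    "\<And>f b. f \<in> sq_integrable \<Longrightarrow> b \<in> sq_integrable \<Longrightarrow> l2sq (solve2 b f) \<le> s2 * l2sq f + t * l2sq b"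
proof -
  obtain e where e: "e > 0" "(1 + 1 / e) * rate < 1"
    by (rule ex_absorbing_weight)
  define s1 where "s1 = (1 + 1 / e) * (A / \<bar>Re c\<bar>)\<^sup>2"
  define s2 where "s2 = (1 + 1 / e) * (B / \<bar>Re c\<bar>)\<^sup>2"
  define t where "t = (1 + e) * (1 / \<bar>Re c\<bar>)\<^sup>2"
  have "s1 * s2 = ((1 + 1 / e) * rate)\<^sup>2"
    by (simp only: s1_def s2_def rate_def power2_eq_square mult.assoc mult.left_commute mult.commute)
  also have "\<dots> < 1"
  proof -
    have "0 \<le> (1 + 1 / e) * rate"
      using e(1) rate(1) by simp
    then show ?thesis
      unfolding power2_less_1_iff using e(2) by linarith
  qed
  finally have "s1 * s2 < 1" .
  show ?thesis
  proof (rule that[of s1 s2 t])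
    show "s1 \<ge> 0" "s2 \<ge> 0" "t \<ge> 0"
      using e(1) by (simp_all add: s1_def s2_def t_def)
    show "s1 * s2 < 1" by fact
    show "l2sq (solve1 a f) \<le> s1 * l2sq f + t * l2sq a" if "f \<in> sq_integrable" "a \<in> sq_integrable" for f a
      unfolding s1_def t_def by (rule solve_l2sq(2)[OF that e(1)])
    show "l2sq (solve2 b f) \<le> s2 * l2sq f + t * l2sq b" if "f \<in> sq_integrable" "b \<in> sq_integrable" for f b
      unfolding s2_def t_def by (rule solve_l2sq(1)[OF that e(1)])
  qed
qed

lemma solution_exists:
  assumes a: "a \<in> sq_integrable" and b: "b \<in> sq_integrable"
  obtains f g where "f \<in> sq_integrable" "g \<in> sq_integrable" "f \<in> AC_loc" "g \<in> AC_loc"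
    "AE x in lebesgue. (f has_vector_derivative (c * f x + (\<alpha> x * g x + a x))) (at x)"
    "AE x in lebesgue. (g has_vector_derivative (- c * g x + (\<beta> x * f x + b x))) (at x)"
proof -
  obtain s1 s2 t where st: "s1 \<ge> 0" "s2 \<ge> 0" "t \<ge> 0" "s1 * s2 < 1"
    and l1: "\<And>f a. f \<in> sq_integrable \<Longrightarrow> a \<in> sq_integrable \<Longrightarrow> l2sq (solve1 a f) \<le> s1 * l2sq f + t * l2sq a"
    and l2: "\<And>f b. f \<in> sq_integrable \<Longrightarrow> b \<in> sq_integrable \<Longrightarrow> l2sq (solve2 b f) \<le> s2 * l2sq f + t * l2sq b"
    using ex_l2sq_bounds by blast
  define S where "S f = solve1 a (solve2 b f)" for f
  have zero: "(\<lambda>_. 0) \<in> sq_integrable"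
    by (simp add: sq_integrable_def sqnorm_def)
  have "\<exists>f\<in>sq_integrable. S f = f"
  proof (rule sq_integrable_fixed_point)
    show "S f \<in> sq_integrable" if "f \<in> sq_integrable" for f
      unfolding S_def by (intro solve_sq_integrable that a b)
    show "0 \<le> rate" "rate < 1" by (rule rate)+
    show "cmod (S f x - S g x) \<le> rate * M"
      if "f \<in> sq_integrable" "g \<in> sq_integrable" "\<And>x. cmod (f x - g x) \<le> M" for f g M x
    proof -
      have "cmod (S f x - S g x) \<le> A * (B * M / \<bar>Re c\<bar>) / \<bar>Re c\<bar>"
        unfolding S_def using that by (intro solve1_diff_le solve2_diff_le solve_sq_integrable a b)
      then show ?thesis by (simp add: rate_def mult.assoc)
    qed
    show "0 \<le> s1 * s2" "s1 * s2 < 1" using st by simp_all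
    show "l2sq (S f) \<le> (s1 * t * l2sq b + t * l2sq a) + s1 * s2 * l2sq f" if "f \<in> sq_integrable" for f
    proof -
      have "l2sq (S f) \<le> s1 * l2sq (solve2 b f) + t * l2sq a"
        unfolding S_def by (intro l1 solve_sq_integrable that a b)
      also have "\<dots> \<le> s1 * (s2 * l2sq f + t * l2sq b) + t * l2sq a"
        using st by (intro add_right_mono mult_left_mono l2 that b)
      finally show ?thesis by (simp add: algebra_simps)
    qed
    show "cmod (S (\<lambda>_. 0) x) \<le> 1 / \<bar>Re c\<bar> + (LINT y|lebesgue. (cmod (\<alpha> y * solve2 b (\<lambda>_. 0) y + a y))\<^sup>2)" for x
      unfolding S_def solve1_def
      by (intro green_op_bounded Re_c rhs_sq_integrable solve_sq_integrable zero a b)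
  qed
  then obtain f where f: "f \<in> sq_integrable" "S f = f" by blast
  define g where "g = solve2 b f"
  have g: "g \<in> sq_integrable" unfolding g_def by (intro solve_sq_integrable f b)
  have fg: "f = green_op c (\<lambda>x. \<alpha> x * g x + a x)" "g = green_op (- c) (\<lambda>x. \<beta> x * f x + b x)"
    using f(2) unfolding S_def g_def[symmetric] by (simp add: solve1_def, simp add: g_def solve2_def)
  note rhs = rhs_sq_integrable(2)[OF g a] rhs_sq_integrable(1)[OF f(1) b]
  show ?thesis
  proof (rule that[OF f(1) g])
    show "f \<in> AC_loc" using green_op_AC_loc[OF Re_c rhs(1)] fg(1) by argo
    show "g \<in> AC_loc" using green_op_AC_loc[OF Re_minus_c rhs(2)] fg(2) by argo
    show "AE x in lebesgue. (f has_vector_derivative (c * f x + (\<alpha> x * g x + a x))) (at x)"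
      using green_op_ODE[OF Re_c rhs(1)] unfolding fg(1)[symmetric] .
    show "AE x in lebesgue. (g has_vector_derivative (- c * g x + (\<beta> x * f x + b x))) (at x)"
      using green_op_ODE[OF Re_minus_c rhs(2)] unfolding fg(2)[symmetric] .
  qed
qed

text \<open>
  Uniqueness for the scalar equations turns any solution of the system into a fixed point, and the
  estimates on \<open>solve1\<close> and \<open>solve2\<close> can be closed because \<open>s1 * s2 < 1\<close>. With \<open>a = b = 0\<close> the bound
  is the injectivity of the operator, in general the boundedness of its inverse.
\<close>

lemma a_priori_bound:
  obtains C where "C \<ge> 0"
    "\<And>f g a b. a \<in> sq_integrable \<Longrightarrow> b \<in> sq_integrable \<Longrightarrow> f \<in> sq_integrable \<Longrightarrow> g \<in> sq_integrable \<Longrightarrow>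
      f \<in> AC_loc \<Longrightarrow> g \<in> AC_loc \<Longrightarrow>
      AE x in lebesgue. (f has_vector_derivative (c * f x + (\<alpha> x * g x + a x))) (at x) \<Longrightarrow>
      AE x in lebesgue. (g has_vector_derivative (- c * g x + (\<beta> x * f x + b x))) (at x) \<Longrightarrow>
      l2sq f + l2sq g \<le> C * (l2sq a + l2sq b)"
proof -
  obtain s1 s2 t where st: "s1 \<ge> 0" "s2 \<ge> 0" "t \<ge> 0" "s1 * s2 < 1"
    and l1: "\<And>f a. f \<in> sq_integrable \<Longrightarrow> a \<in> sq_integrable \<Longrightarrow> l2sq (solve1 a f) \<le> s1 * l2sq f + t * l2sq a"
    and l2: "\<And>f b. f \<in> sq_integrable \<Longrightarrow> b \<in> sq_integrable \<Longrightarrow> l2sq (solve2 b f) \<le> s2 * l2sq f + t * l2sq b"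
    using ex_l2sq_bounds by blast
  define T where "T = t * (1 + s1) / (1 - s1 * s2)"
  have "T \<ge> 0" using st by (simp add: T_def)
  show ?thesis
  proof (rule that[of "T + s2 * T + t"])
    show "0 \<le> T + s2 * T + t" using \<open>T \<ge> 0\<close> st by simp
    fix f g a b
    assume a: "a \<in> sq_integrable" and b: "b \<in> sq_integrable" and f: "f \<in> sq_integrable" "f \<in> AC_loc"
      and g: "g \<in> sq_integrable" "g \<in> AC_loc"
      and f': "AE x in lebesgue. (f has_vector_derivative (c * f x + (\<alpha> x * g x + a x))) (at x)"
      and g': "AE x in lebesgue. (g has_vector_derivative (- c * g x + (\<beta> x * f x + b x))) (at x)"
    have "f = solve1 a g"
      unfolding solve1_def by (rule sq_integrable_green_op_unique[OF Re_c rhs_sq_integrable(2)[OF g(1) a] f f'])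
    then have lf: "l2sq f \<le> s1 * l2sq g + t * l2sq a"
      using l1[OF g(1) a] by simp
    have "g = solve2 b f"
      unfolding solve2_def by (rule sq_integrable_green_op_unique[OF Re_minus_c rhs_sq_integrable(1)[OF f(1) b] g g'])
    then have lg: "l2sq g \<le> s2 * l2sq f + t * l2sq b"
      using l2[OF f(1) b] by simp
    define E where "E = l2sq a + l2sq b"
    have E: "l2sq a \<le> E" "l2sq b \<le> E" using l2sq_nonneg by (simp_all add: E_def)
    have "l2sq f \<le> s1 * (s2 * l2sq f + t * E) + t * E"
    proof -
      have "t * l2sq a \<le> t * E" "t * l2sq b \<le> t * E"
        using E st by (simp_all add: mult_left_mono)
      moreover have "s1 * l2sq g \<le> s1 * (s2 * l2sq f + t * E)"
        using lg \<open>t * l2sq b \<le> t * E\<close> st by (intro mult_left_mono) auto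
      ultimately show ?thesis using lf by linarith
    qed
    then have "(1 - s1 * s2) * l2sq f \<le> t * (1 + s1) * E"
      by (simp add: algebra_simps)
    then have fT: "l2sq f \<le> T * E"
      using st by (simp add: T_def pos_le_divide_eq mult.commute)
    have "l2sq g \<le> s2 * (T * E) + t * E"
      using lg mult_left_mono[OF fT st(2)] mult_left_mono[OF E(2) st(3)] by linarith
    with fT show "l2sq f + l2sq g \<le> (T + s2 * T + t) * (l2sq a + l2sq b)"
      unfolding E_def[symmetric] by (simp add: algebra_simps)
  qed
qed

end

section \<open>The Dirac operator\<close>

lemma Linf_AE_bound:
  assumes "p \<in> Linf"
  shows "p \<in> borel_measurable lebesgue" "AE x in lebesgue. cmod (p x) \<le> Linf_norm p" "0 \<le> Linf_norm p"
proof -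
  let ?E = "esssup lebesgue (\<lambda>x. ereal (cmod (p x)))"
  show m: "p \<in> borel_measurable lebesgue"
    using assms by (simp add: Linf_def)
  have fin: "?E < \<infinity>"
    using assms by (simp add: Linf_def)
  have "esssup (lebesgue :: real measure) (\<lambda>x. 0 :: ereal) = 0"
    by (intro esssup_const) simp
  moreover have "esssup (lebesgue :: real measure) (\<lambda>x. 0 :: ereal) \<le> ?E"
    by (rule esssup_mono) simp_all
  ultimately have "0 \<le> ?E" by (simp only:)
  then obtain P where P: "?E = ereal P" "0 \<le> P"
    using fin by (cases ?E) simp_all
  then show "0 \<le> Linf_norm p"
    by (simp add: Linf_norm_def)
  show "AE x in lebesgue. cmod (p x) \<le> Linf_norm p"
    using esssup_AE[of "\<lambda>x. ereal (cmod (p x))" lebesgue] unfolding P(1) Linf_norm_def by simp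
qed

lemma norm_vec2_squared:
  fixes v :: "complex ^ 2"
  shows "(norm v)\<^sup>2 = (cmod (v $ 1))\<^sup>2 + (cmod (v $ 2))\<^sup>2"
  by (simp add: norm_vec_def L2_set_def sum_2)

lemma vec2_borel_measurable_iff:
  fixes F :: "real \<Rightarrow> complex ^ 2"
  shows "F \<in> borel_measurable lebesgue \<longleftrightarrow> (\<forall>k. (\<lambda>x. F x $ k) \<in> borel_measurable lebesgue)"
proof (intro iffI allI)
  fix k
  assume F: "F \<in> borel_measurable lebesgue"
  have "(\<lambda>v :: complex ^ 2. v $ k) \<in> borel_measurable borel"
    by (rule borel_measurable_continuous_onI[OF linear_continuous_on[OF bounded_linear_vec_nth]])
  from measurable_compose[OF F this] show "(\<lambda>x. F x $ k) \<in> borel_measurable lebesgue" .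
next
  assume F: "\<forall>k. (\<lambda>x. F x $ k) \<in> borel_measurable lebesgue"
  show "F \<in> borel_measurable lebesgue"
  proof (rule borel_measurable_euclidean_space[THEN iffD2], rule ballI)
    fix i :: "complex ^ 2"
    assume "i \<in> Basis"
    then obtain k b where i: "i = axis k b"
      unfolding Basis_vec_def by blast
    have "(\<lambda>x. F x $ k \<bullet> b) \<in> borel_measurable lebesgue"
      by (rule borel_measurable_inner[OF F[rule_format] borel_measurable_const])
    then show "(\<lambda>x. F x \<bullet> i) \<in> borel_measurable lebesgue"
      by (simp add: i inner_axis)
  qed
qed

lemma L2_components:
  assumes "F \<in> L2"
  shows "(\<lambda>x. F x $ k) \<in> sq_integrable"
    and "L2_norm F = sqrt (l2sq (\<lambda>x. F x $ 1) + l2sq (\<lambda>x. F x $ 2))"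
proof -
  have int: "integrable lebesgue (\<lambda>x. (norm (F x))\<^sup>2)" and m: "\<And>k. (\<lambda>x. F x $ k) \<in> borel_measurable lebesgue"
    using assms by (auto simp: L2_def vec2_borel_measurable_iff)
  have comp: "integrable lebesgue (\<lambda>x. (cmod (F x $ k))\<^sup>2)" for k
  proof (rule Bochner_Integration.integrable_bound[OF int])
    show "(\<lambda>x. (cmod (F x $ k))\<^sup>2) \<in> borel_measurable lebesgue"
      using m[of k] by measurable
    show "AE x in lebesgue. norm ((cmod (F x $ k))\<^sup>2) \<le> norm ((norm (F x))\<^sup>2)"
      by (intro AE_I2) (simp add: power_mono Finite_Cartesian_Product.norm_nth_le)
  qed
  show "(\<lambda>x. F x $ k) \<in> sq_integrable"
    using m[of k] comp[of k]
    by (simp add: sq_integrable_def sqnorm_def integrable_iff_bounded)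
  show "L2_norm F = sqrt (l2sq (\<lambda>x. F x $ 1) + l2sq (\<lambda>x. F x $ 2))"
    using comp by (simp add: L2_norm_def norm_vec2_squared l2sq_def)
qed

lemma L2_I:
  assumes "\<And>k. (\<lambda>x. F x $ k) \<in> sq_integrable"
  shows "F \<in> L2"
proof -
  have "integrable lebesgue (\<lambda>x. (cmod (F x $ k))\<^sup>2)" for k
    by (rule sq_integrableD(2)[OF assms])
  then show ?thesis
    using sq_integrableD(1)[OF assms]
    by (simp add: L2_def vec2_borel_measurable_iff norm_vec2_squared)
qed

lemma L2_diff_smult:
  assumes "F \<in> L2" "G \<in> L2"
  shows "(\<lambda>x. F x - z *s G x) \<in> L2"
  by (rule L2_I)
    (use sq_integrable_diff[OF L2_components(1)[OF assms(1)] sq_integrable_cmult[OF L2_components(1)[OF assms(2)]]]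
      in simp)

lemma L2_AE_cong:
  assumes "F \<in> L2" "AE x in lebesgue. F x = G x"
  shows "G \<in> L2"
proof -
  have "F \<in> borel_measurable lebesgue" using assms(1) by (simp add: L2_def)
  then have m: "G \<in> borel_measurable lebesgue"
    using assms(2) by (rule borel_measurable_AE)
  show ?thesis
  proof (rule L2_I)
    fix k
    have "(\<lambda>x. G x $ k) \<in> borel_measurable lebesgue"
      using m by (simp add: vec2_borel_measurable_iff)
    moreover have ae: "AE x in lebesgue. cmod (G x $ k) \<le> 1 * cmod (F x $ k)"
      using assms(2) by eventually_elim simp
    ultimately show "(\<lambda>x. G x $ k) \<in> sq_integrable"
      by (intro sq_integrable_AE_bound[OF _ L2_components(1)[OF assms(1)] ae]) simp_all
  qed
qed

lemma has_vector_derivative_vec2: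
  fixes F :: "real \<Rightarrow> complex ^ 2"
  shows "(F has_vector_derivative D) (at x) \<longleftrightarrow> (\<forall>k. ((\<lambda>t. F t $ k) has_vector_derivative D $ k) (at x))"
proof (intro iffI allI)
  fix k
  assume "(F has_vector_derivative D) (at x)"
  then show "((\<lambda>t. F t $ k) has_vector_derivative D $ k) (at x)"
    by (rule bounded_linear.has_vector_derivative[OF bounded_linear_vec_nth])
next
  assume F: "\<forall>k. ((\<lambda>t. F t $ k) has_vector_derivative D $ k) (at x)"
  show "(F has_vector_derivative D) (at x)"
    unfolding has_vector_derivative_def
  proof (rule has_derivative_componentwise_within[THEN iffD2], rule ballI)
    fix i :: "complex ^ 2"
    assume "i \<in> Basis"
    then obtain k b where i: "i = axis k b"
      unfolding Basis_vec_def by blast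
    have "((\<lambda>t. F t $ k) has_derivative (\<lambda>t. t *\<^sub>R D $ k)) (at x)"
      using F by (simp add: has_vector_derivative_def)
    from bounded_linear.has_derivative[OF bounded_linear_inner_left this, of b]
    show "((\<lambda>t. F t \<bullet> i) has_derivative (\<lambda>t. t *\<^sub>R D \<bullet> i)) (at x)"
      by (simp add: i inner_axis)
  qed
qed

text \<open>
  The resolvent equation \<open>(\<DD> - z) \<Psi> = F\<close> solved for the derivative. The
  two components carry opposite signs of \<open>c\<close> because of \<open>\<sigma>\<^sub>3\<close>.
\<close>

lemma dirac_eq_iff:
  fixes h :: real and z :: complex
  assumes "h \<noteq> 0" "(\<Psi> has_vector_derivative D) (at x)"
  defines "c \<equiv> - \<i> * z / complex_of_real h"
  shows "dirac h p q \<Psi> x - z *s \<Psi> x = F \<longleftrightarrow>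
    D $ 1 = c * \<Psi> x $ 1 + (q x / of_real h * \<Psi> x $ 2 + (- \<i> / of_real h) * F $ 1) \<and>
    D $ 2 = - c * \<Psi> x $ 2 + (p x / of_real h * \<Psi> x $ 1 + (\<i> / of_real h) * F $ 2)"
proof -
  have "vector_derivative \<Psi> (at x) = D"
    by (rule vector_derivative_at[OF assms(2)])
  then have comp: "(dirac h p q \<Psi> x - z *s \<Psi> x) $ 1 = \<i> * of_real h * D $ 1 - \<i> * q x * \<Psi> x $ 2 - z * \<Psi> x $ 1"
    "(dirac h p q \<Psi> x - z *s \<Psi> x) $ 2 = - \<i> * of_real h * D $ 2 + \<i> * p x * \<Psi> x $ 1 - z * \<Psi> x $ 2"
    by (simp_all add: dirac_def sigma3_def potential_def matrix_vector_mult_def sum_2)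
  let ?H = "complex_of_real h"
  have plus: "\<i> * ?H * d = E \<longleftrightarrow> d = - \<i> / ?H * E" for d E
  proof
    assume "\<i> * ?H * d = E"
    then have "- \<i> / ?H * E = - \<i> / ?H * (\<i> * ?H * d)" by (simp only:)
    then show "d = - \<i> / ?H * E" using assms(1) by simp
  qed (use assms(1) in simp)
  have one: "\<i> * ?H * d - \<i> * Q * v - z * u = w \<longleftrightarrow>
      d = - \<i> * z / ?H * u + (Q / ?H * v + (- \<i> / ?H) * w)" for d Q v u w
  proof -
    have "\<i> * ?H * d - \<i> * Q * v - z * u = w \<longleftrightarrow> \<i> * ?H * d = w + z * u + \<i> * Q * v"
      by (auto simp: algebra_simps)
    moreover have "- \<i> / ?H * (w + z * u + \<i> * Q * v) = - \<i> * z / ?H * u + (Q / ?H * v + (- \<i> / ?H) * w)"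
      by (simp add: distrib_left mult.assoc)
    ultimately show ?thesis unfolding plus by simp
  qed
  have two: "- \<i> * ?H * d + \<i> * P * u - z * v = w \<longleftrightarrow>
      d = - (- \<i> * z / ?H) * v + (P / ?H * u + (\<i> / ?H) * w)" for d P v u w
  proof -
    have "- \<i> * ?H * d + \<i> * P * u - z * v = w \<longleftrightarrow> \<i> * ?H * d = - w - z * v + \<i> * P * u"
      by (auto simp: algebra_simps)
    moreover have "- \<i> / ?H * (- w - z * v + \<i> * P * u) = - (- \<i> * z / ?H) * v + (P / ?H * u + (\<i> / ?H) * w)"
      by (simp add: distrib_left right_diff_distrib mult.assoc)
    ultimately show ?thesis unfolding plus by simp
  qed
  show ?thesis
    unfolding vec_eq_iff forall_2 comp c_def one two ..
qed

lemma l2sq_cmult: "l2sq (\<lambda>x. k * f x) = (cmod k)\<^sup>2 * l2sq f"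
  by (simp add: l2sq_def norm_mult power_mult_distrib)

theorem lemma4p1:
  fixes h :: real and p q :: "real \<Rightarrow> complex" and z :: complex
  assumes "h > 0"
    and "\<forall>x. p (x + 1) = p x" and "\<forall>x. q (x + 1) = q x"
    and "p \<in> Linf" and "q \<in> Linf"
    and "z \<in> dirac_spectrum h p q"
  shows "\<bar>Im z\<bar> \<le> sqrt (Linf_norm p * Linf_norm q)"
proof (rule ccontr)
  assume "\<not> \<bar>Im z\<bar> \<le> sqrt (Linf_norm p * Linf_norm q)"
  then have large: "sqrt (Linf_norm p * Linf_norm q) < \<bar>Im z\<bar>" by simp
  note p = Linf_AE_bound[OF \<open>p \<in> Linf\<close>]
  note q = Linf_AE_bound[OF \<open>q \<in> Linf\<close>]
  have pq: "0 \<le> Linf_norm p * Linf_norm q" using p(3) q(3) by simp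
  then have Im_sq: "Linf_norm p * Linf_norm q < (Im z)\<^sup>2"
    using large by (metis real_sqrt_abs real_sqrt_less_iff)
  define c where "c = - \<i> * z / complex_of_real h"
  have Re_c: "Re c = Im z / h"
    by (simp add: c_def)
  define \<alpha> where "\<alpha> x = q x / complex_of_real h" for x
  define \<beta> where "\<beta> x = p x / complex_of_real h" for x
  interpret dirac_system c \<alpha> \<beta> "Linf_norm q / h" "Linf_norm p / h"
  proof
    have "Im z \<noteq> 0" using Im_sq pq by auto
    then show "Re c \<noteq> 0" using \<open>h > 0\<close> by (simp add: Re_c)
    show "\<alpha> \<in> borel_measurable lebesgue" "\<beta> \<in> borel_measurable lebesgue"
      unfolding \<alpha>_def \<beta>_def by (intro borel_measurable_divide p(1) q(1) borel_measurable_const)+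
    show "AE x in lebesgue. cmod (\<alpha> x) \<le> Linf_norm q / h"
      using q(2) by eventually_elim (use \<open>h > 0\<close> in \<open>simp add: \<alpha>_def norm_divide divide_right_mono\<close>)
    show "AE x in lebesgue. cmod (\<beta> x) \<le> Linf_norm p / h"
      using p(2) by eventually_elim (use \<open>h > 0\<close> in \<open>simp add: \<beta>_def norm_divide divide_right_mono\<close>)
    show "0 \<le> Linf_norm q / h" "0 \<le> Linf_norm p / h"
      using p(3) q(3) \<open>h > 0\<close> by simp_all
    show "Linf_norm q / h * (Linf_norm p / h) < (Re c)\<^sup>2"
      using Im_sq \<open>h > 0\<close> by (simp add: Re_c power_divide power2_eq_square divide_strict_right_mono mult.commute)
  qed
  let ?T = "dirac h p q" and ?D = "dirac_domain h p q"
  have dom: "\<And>k. (\<lambda>x. \<Psi> x $ k) \<in> sq_integrable" "\<And>k. (\<lambda>x. \<Psi> x $ k) \<in> AC_loc"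
    "\<Psi> \<in> L2" "?T \<Psi> \<in> L2" "AE x in lebesgue. \<Psi> differentiable (at x)" if "\<Psi> \<in> ?D" for \<Psi>
    using that L2_components(1)[of \<Psi>] by (auto simp: dirac_domain_def)
  \<comment> \<open>The quantifier over \<open>F\<close> inside the almost-everywhere statement lets two elements of the domain be
    compared later with one common value of \<open>F\<close> at the point.\<close>
  have ode: "AE x in lebesgue. \<forall>F. ?T \<Psi> x - z *s \<Psi> x = F \<longrightarrow>
      ((\<lambda>t. \<Psi> t $ 1) has_vector_derivative
        (c * \<Psi> x $ 1 + (\<alpha> x * \<Psi> x $ 2 + (- \<i> / of_real h) * F $ 1))) (at x) \<and>
      ((\<lambda>t. \<Psi> t $ 2) has_vector_derivative
        (- c * \<Psi> x $ 2 + (\<beta> x * \<Psi> x $ 1 + (\<i> / of_real h) * F $ 2))) (at x)"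
    if "\<Psi> \<in> ?D" for \<Psi>
    using dom(5)[OF that]
  proof eventually_elim
    case (elim x)
    then have D: "(\<Psi> has_vector_derivative vector_derivative \<Psi> (at x)) (at x)"
      by (simp add: vector_derivative_works)
    show ?case
      using dirac_eq_iff[OF _ D, of h p q z] \<open>h > 0\<close> D[unfolded has_vector_derivative_vec2]
      unfolding c_def \<alpha>_def \<beta>_def by (metis less_irrefl)
  qed
  obtain C where "C \<ge> 0" and C: "\<And>f g a b. a \<in> sq_integrable \<Longrightarrow> b \<in> sq_integrable \<Longrightarrow>
      f \<in> sq_integrable \<Longrightarrow> g \<in> sq_integrable \<Longrightarrow> f \<in> AC_loc \<Longrightarrow> g \<in> AC_loc \<Longrightarrow>
      AE x in lebesgue. (f has_vector_derivative (c * f x + (\<alpha> x * g x + a x))) (at x) \<Longrightarrow>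
      AE x in lebesgue. (g has_vector_derivative (- c * g x + (\<beta> x * f x + b x))) (at x) \<Longrightarrow>
      l2sq f + l2sq g \<le> C * (l2sq a + l2sq b)"
    using a_priori_bound by blast
  \<comment> \<open>The difference of two solutions solves the system without sources; the a priori bound makes
    both of its components vanish.\<close>
  have inj: "AE x in lebesgue. \<Psi> x = \<Phi> x"
    if \<Psi>: "\<Psi> \<in> ?D" and \<Phi>: "\<Phi> \<in> ?D" and eq: "AE x in lebesgue. ?T \<Psi> x - z *s \<Psi> x = ?T \<Phi> x - z *s \<Phi> x"
    for \<Psi> \<Phi>
  proof -
    define f where "f x = \<Psi> x $ 1 - \<Phi> x $ 1" for x
    define g where "g x = \<Psi> x $ 2 - \<Phi> x $ 2" for x
    have "AE x in lebesgue. (f has_vector_derivative (c * f x + (\<alpha> x * g x + 0))) (at x) \<and>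
      (g has_vector_derivative (- c * g x + (\<beta> x * f x + 0))) (at x)"
      using ode[OF \<Psi>] ode[OF \<Phi>] eq
    proof eventually_elim
      case (elim x)
      define F where "F = ?T \<Psi> x - z *s \<Psi> x"
      note \<Psi>' = elim(1)[rule_format, OF F_def[symmetric]]
      note \<Phi>' = elim(2)[rule_format, OF elim(3)[symmetric], folded F_def]
      have "(f has_vector_derivative (c * \<Psi> x $ 1 + (\<alpha> x * \<Psi> x $ 2 + (- \<i> / of_real h) * F $ 1))
          - (c * \<Phi> x $ 1 + (\<alpha> x * \<Phi> x $ 2 + (- \<i> / of_real h) * F $ 1))) (at x)"
        unfolding f_def using \<Psi>' \<Phi>' by (intro has_vector_derivative_diff) auto
      moreover have "(g has_vector_derivative (- c * \<Psi> x $ 2 + (\<beta> x * \<Psi> x $ 1 + (\<i> / of_real h) * F $ 2))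
          - (- c * \<Phi> x $ 2 + (\<beta> x * \<Phi> x $ 1 + (\<i> / of_real h) * F $ 2))) (at x)"
        unfolding g_def using \<Psi>' \<Phi>' by (intro has_vector_derivative_diff) auto
      ultimately show ?case
        by (simp add: f_def g_def algebra_simps)
    qed
    then have f': "AE x in lebesgue. (f has_vector_derivative (c * f x + (\<alpha> x * g x + 0))) (at x)"
      and g': "AE x in lebesgue. (g has_vector_derivative (- c * g x + (\<beta> x * f x + 0))) (at x)"
      by auto
    have zero: "(\<lambda>_. 0) \<in> sq_integrable"
      by (simp add: sq_integrable_def sqnorm_def)
    have sq: "f \<in> sq_integrable" "g \<in> sq_integrable"
      unfolding f_def g_def by (intro sq_integrable_diff dom \<Psi> \<Phi>)+
    have ac: "f \<in> AC_loc" "g \<in> AC_loc"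
      using dom(2)[OF \<Psi>] dom(2)[OF \<Phi>] unfolding f_def g_def AC_loc_def
      by (auto intro!: abs_cont_on_interval_diff)
    have "l2sq f + l2sq g \<le> C * (l2sq (\<lambda>_. 0) + l2sq (\<lambda>_. 0))"
      by (rule C[OF zero zero sq ac f' g'])
    then have "l2sq f = 0" "l2sq g = 0"
      using l2sq_nonneg[of f] l2sq_nonneg[of g] by (simp_all add: l2sq_def[of "\<lambda>_. 0"])
    then have "AE x in lebesgue. f x = 0" "AE x in lebesgue. g x = 0"
      unfolding l2sq_def using sq_integrableD(2)[OF sq(1)] sq_integrableD(2)[OF sq(2)]
      by (simp_all add: integral_nonneg_eq_0_iff_AE)
    then show ?thesis
      by eventually_elim (simp add: f_def g_def vec_eq_iff forall_2)
  qed
  have surj: "\<exists>\<Psi>\<in>?D. AE x in lebesgue. ?T \<Psi> x - z *s \<Psi> x = F x" if F: "F \<in> L2" for F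
  proof -
    define a where "a x = (- \<i> / of_real h) * F x $ 1" for x
    define b where "b x = (\<i> / of_real h) * F x $ 2" for x
    have "a \<in> sq_integrable" "b \<in> sq_integrable"
      unfolding a_def b_def by (intro sq_integrable_cmult L2_components(1)[OF F])+
    then obtain f g where sq: "f \<in> sq_integrable" "g \<in> sq_integrable" and ac: "f \<in> AC_loc" "g \<in> AC_loc"
      and f': "AE x in lebesgue. (f has_vector_derivative (c * f x + (\<alpha> x * g x + a x))) (at x)"
      and g': "AE x in lebesgue. (g has_vector_derivative (- c * g x + (\<beta> x * f x + b x))) (at x)"
      by (rule solution_exists)
    define \<Psi> :: "real \<Rightarrow> complex ^ 2" where "\<Psi> x = vector [f x, g x]" for x
    have \<Psi>12: "\<Psi> x $ 1 = f x" "\<Psi> x $ 2 = g x" for x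
      by (simp_all add: \<Psi>_def)
    have \<Psi>_comp: "(\<lambda>x. \<Psi> x $ k) \<in> sq_integrable" "(\<lambda>x. \<Psi> x $ k) \<in> AC_loc" for k
      using exhaust_2[of k] sq ac by (auto simp: \<Psi>12)
    then have \<Psi>_L2: "\<Psi> \<in> L2" by (intro L2_I)
    have AE_D: "AE x in lebesgue. \<Psi> differentiable (at x) \<and> ?T \<Psi> x - z *s \<Psi> x = F x"
      using f' g'
    proof eventually_elim
      case (elim x)
      define D :: "complex ^ 2" where
        "D = vector [c * f x + (\<alpha> x * g x + a x), - c * g x + (\<beta> x * f x + b x)]"
      have D: "(\<Psi> has_vector_derivative D) (at x)"
        unfolding has_vector_derivative_vec2 forall_2 \<Psi>12 using elim by (simp add: D_def)
      have "?T \<Psi> x - z *s \<Psi> x = F x"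
        using dirac_eq_iff[OF _ D, of h p q z "F x"] \<open>h > 0\<close>
        by (simp add: \<Psi>12 D_def a_def b_def \<alpha>_def \<beta>_def c_def)
      then show ?case
        using D by (auto intro: differentiableI_vector)
    qed
    then have eqF: "AE x in lebesgue. ?T \<Psi> x - z *s \<Psi> x = F x" and diff: "AE x in lebesgue. \<Psi> differentiable (at x)"
      by auto
    \<comment> \<open>Membership in \<open>L\<^sup>2\<close> of \<open>?T \<Psi>\<close>, including its measurability, comes from the equation.\<close>
    have "AE x in lebesgue. F x - (- z) *s \<Psi> x = ?T \<Psi> x"
      using eqF by eventually_elim (simp add: vec_eq_iff algebra_simps)
    then have "?T \<Psi> \<in> L2"
      by (rule L2_AE_cong[OF L2_diff_smult[OF F \<Psi>_L2]])
    then have "\<Psi> \<in> ?D"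
      using \<Psi>_L2 \<Psi>_comp diff by (simp add: dirac_domain_def)
    then show ?thesis using eqF by blast
  qed
  have bdd: "L2_norm \<Psi> \<le> sqrt (C / h\<^sup>2) * L2_norm (\<lambda>x. ?T \<Psi> x - z *s \<Psi> x)" if \<Psi>: "\<Psi> \<in> ?D" for \<Psi>
  proof -
    define F where "F x = ?T \<Psi> x - z *s \<Psi> x" for x
    have F: "F \<in> L2"
      unfolding F_def by (rule L2_diff_smult[OF dom(4)[OF \<Psi>] dom(3)[OF \<Psi>]])
    have ode_F: "AE x in lebesgue.
      ((\<lambda>t. \<Psi> t $ 1) has_vector_derivative
        (c * \<Psi> x $ 1 + (\<alpha> x * \<Psi> x $ 2 + (- \<i> / of_real h) * F x $ 1))) (at x) \<and>
      ((\<lambda>t. \<Psi> t $ 2) has_vector_derivative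
        (- c * \<Psi> x $ 2 + (\<beta> x * \<Psi> x $ 1 + (\<i> / of_real h) * F x $ 2))) (at x)"
      using ode[OF \<Psi>] by eventually_elim (simp add: F_def)
    have "l2sq (\<lambda>x. \<Psi> x $ 1) + l2sq (\<lambda>x. \<Psi> x $ 2)
      \<le> C * (l2sq (\<lambda>x. (- \<i> / of_real h) * F x $ 1) + l2sq (\<lambda>x. (\<i> / of_real h) * F x $ 2))"
      using ode_F unfolding AE_conj_iff
      by (elim conjE) (rule C[OF sq_integrable_cmult[OF L2_components(1)[OF F]]
        sq_integrable_cmult[OF L2_components(1)[OF F]] dom(1)[OF \<Psi>] dom(1)[OF \<Psi>] dom(2)[OF \<Psi>] dom(2)[OF \<Psi>]])
    also have "\<dots> = C * ((1 / h)\<^sup>2 * l2sq (\<lambda>x. F x $ 1) + (1 / h)\<^sup>2 * l2sq (\<lambda>x. F x $ 2))"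
      unfolding l2sq_cmult using \<open>h > 0\<close> by (simp add: norm_divide)
    also have "\<dots> = C / h\<^sup>2 * (l2sq (\<lambda>x. F x $ 1) + l2sq (\<lambda>x. F x $ 2))"
      by (simp add: power_divide distrib_left)
    finally show ?thesis
      unfolding F_def[symmetric] L2_components(2)[OF F] L2_components(2)[OF dom(3)[OF \<Psi>]]
      by (simp only: real_sqrt_mult[symmetric] real_sqrt_le_iff)
  qed
  have "z \<in> L2_resolvent_set ?D ?T"
    unfolding L2_resolvent_set_def using inj surj bdd by blast
  then show False
    using \<open>z \<in> dirac_spectrum h p q\<close> by (simp add: dirac_spectrum_def L2_spectrum_def)
qed

end
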